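(* Let $G$ and $H$ be simply connected nilpotent Lie groups, and let $N\le G$ and $M\le H$ be uniform lattices. Suppose there are Lie group homomorphisms $\Theta_G:G\to\mathbb R^d$ and $\Theta_H:H\to\mathbb R^d$ with nilpotent kernels such that: (i) $\Theta_G(N)\subset\mathbb Z^d$, $\Theta_H(M)\subset\mathbb Z^d$, and $\Theta_G|_N$, $\Theta_H|_M$ agree (up to automorphisms of $\mathbb Z^d$) with the Abelianization maps $N\to N_{\mathrm{ab}}\cong\mathbb Z^d$ and $M\to M_{\mathrm{ab}}\cong\mathbb Z^d$; (ii) there exist a quasi-isometry $\Phi:G\to H$, a linear map $L:\mathbb R^d\to\mathbb R^d$, a vector $b\in\mathbb R^d$ and $C_0\ge0$ such that $$\big\|\Theta_H(\Phi(g))-\big(L(\Theta_G(g))+b\big)\big\|\le C_0\qquad\text{for all }g\in G.$$ Let $\Psi:N\to M$ be a quasi-isometry at bounded distance from $\Phi|_N$. Then $\Psi$ has bounded Abelian defect, i.e. $$\sup_{x,y\in N}\big\|\pi_M(\Psi(xy))-\pi_M(\Psi(x))-\pi_M(\Psi(y))\big\|<\infty.$$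
   Context: $G$, $H$ carry left-invariant Riemannian metrics, lattices carry word metrics; "bounded distance" means $\sup_{x\in N}d_H(\Psi(x),\Phi(x))<\infty$. $M_{\mathrm{ab}}=M/[M,M]$, and $\pi_M:M\to M_{\mathrm{ab}}\otimes_{\mathbb Z}\mathbb R$ is the composition of the Abelianization with the canonical map to $M_{\mathrm{ab}}\otimes_{\mathbb Z}\mathbb R$, on which a norm is fixed. *)

theory Defs
  imports "HOL-Analysis.Analysis" "HOL-Algebra.Free_Abelian_Groups" "HOL-Algebra.Generated_Groups"
begin

section \<open>Smooth manifolds and Lie groups\<close>

(* C^k and smooth maps on an open set S of a finite-dimensional normed space; the derivatives of
   order k + 1 are the derivatives of order k of all directional derivatives. *)
primrec Ck_on :: "nat \<Rightarrow> ('a::real_normed_vector \<Rightarrow> 'b::real_normed_vector) \<Rightarrow> 'a set \<Rightarrow> bool" where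
  "Ck_on 0 f S \<longleftrightarrow> continuous_on S f"
| "Ck_on (Suc k) f S \<longleftrightarrow>
     (\<forall>x\<in>S. f differentiable (at x)) \<and> (\<forall>v. Ck_on k (\<lambda>x. frechet_derivative f (at x) v) S)"

definition smooth_on :: "('a::real_normed_vector \<Rightarrow> 'b::real_normed_vector) \<Rightarrow> 'a set \<Rightarrow> bool" where
  "smooth_on f S \<longleftrightarrow> (\<forall>k. Ck_on k f S)"

type_synonym ('g, 'm) chart = "'g set \<times> ('g \<Rightarrow> 'm)"

(* The model space of the charts is a finite-dimensional real normed space.  The class
   euclidean_space is not used because it excludes dimension 0. *)
definition smooth_manifold :: "'g topology \<Rightarrow> ('g, 'm::real_normed_vector) chart set \<Rightarrow> bool" where
  "smooth_manifold X A \<longleftrightarrow>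
     (\<exists>B::'m set. finite B \<and> span B = UNIV) \<and>
     Hausdorff_space X \<and> second_countable X \<and> topspace X = (\<Union>(U, \<phi>)\<in>A. U) \<and>
     (\<forall>(U, \<phi>)\<in>A. openin X U \<and> open (\<phi> ` U) \<and>
        homeomorphic_map (subtopology X U) (top_of_set (\<phi> ` U)) \<phi>) \<and>
     (\<forall>(U, \<phi>)\<in>A. \<forall>(V, \<psi>)\<in>A. smooth_on (\<psi> \<circ> inv_into U \<phi>) (\<phi> ` (U \<inter> V)))"

definition smooth_map ::
  "'g topology \<Rightarrow> ('g, 'm::real_normed_vector) chart set \<Rightarrow>
   'h topology \<Rightarrow> ('h, 'k::real_normed_vector) chart set \<Rightarrow> ('g \<Rightarrow> 'h) \<Rightarrow> bool" where
  "smooth_map X A Y B f \<longleftrightarrow> continuous_map X Y f \<and>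
     (\<forall>(U, \<phi>)\<in>A. \<forall>(V, \<psi>)\<in>B. smooth_on (\<psi> \<circ> f \<circ> inv_into U \<phi>) (\<phi> ` (U \<inter> f -` V)))"

definition prod_atlas ::
  "('g, 'm) chart set \<Rightarrow> ('h, 'k) chart set \<Rightarrow> ('g \<times> 'h, 'm \<times> 'k) chart set" where
  "prod_atlas A B = (\<lambda>((U, \<phi>), (V, \<psi>)). (U \<times> V, map_prod \<phi> \<psi>)) ` (A \<times> B)"

record ('g, 'm) lie_group = "'g monoid" +
  topol :: "'g topology"
  atlas :: "('g, 'm) chart set"

definition is_lie_group :: "('g, 'm::real_normed_vector) lie_group \<Rightarrow> bool" where
  "is_lie_group G \<longleftrightarrow> group G \<and> topspace (topol G) = carrier G \<and>
     smooth_manifold (topol G) (atlas G) \<and>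
     smooth_map (prod_topology (topol G) (topol G)) (prod_atlas (atlas G) (atlas G))
       (topol G) (atlas G) (\<lambda>(x, y). x \<otimes>\<^bsub>G\<^esub> y) \<and>
     smooth_map (topol G) (atlas G) (topol G) (atlas G) (\<lambda>x. inv\<^bsub>G\<^esub> x)"

definition lie_group_hom ::
  "('g, 'm::real_normed_vector) lie_group \<Rightarrow> ('h, 'k::real_normed_vector) lie_group \<Rightarrow>
   ('g \<Rightarrow> 'h) \<Rightarrow> bool" where
  "lie_group_hom G H f \<longleftrightarrow>
     f \<in> hom G H \<and> smooth_map (topol G) (atlas G) (topol H) (atlas H) f"

(* The analogue of the library's simply_connected for an abstract topology. *)
definition simply_connected_space :: "'a topology \<Rightarrow> bool" where
  "simply_connected_space X \<longleftrightarrow> path_connected_space X \<and>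
     (\<forall>p. pathin X p \<and> p 0 = p 1 \<longrightarrow>
        (\<exists>a\<in>topspace X.
           homotopic_with (\<lambda>r. r 0 = r 1) (top_of_set {0..1::real}) X p (\<lambda>_. a)))"

primrec lower_central :: "('a, 'b) monoid_scheme \<Rightarrow> nat \<Rightarrow> 'a set" where
  "lower_central G 0 = carrier G"
| "lower_central G (Suc n) =
     generate G {a \<otimes>\<^bsub>G\<^esub> b \<otimes>\<^bsub>G\<^esub> inv\<^bsub>G\<^esub> a \<otimes>\<^bsub>G\<^esub> inv\<^bsub>G\<^esub> b |a b. a \<in> carrier G \<and> b \<in> lower_central G n}"

definition nilpotent_group :: "('a, 'b) monoid_scheme \<Rightarrow> bool" where
  "nilpotent_group G \<longleftrightarrow> group G \<and> (\<exists>n. lower_central G n = {\<one>\<^bsub>G\<^esub>})"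

section \<open>The Lie group $R^d$ and the lattice $Z^d$\<close>

(* A type 'v together with an e satisfying this is $R^d$ with standard basis e 0, ..., e (d - 1),
   including the case d = 0. *)
definition standard_basis :: "nat \<Rightarrow> (nat \<Rightarrow> 'v::real_inner) \<Rightarrow> bool" where
  "standard_basis d e \<longleftrightarrow>
     (\<forall>i<d. \<forall>j<d. e i \<bullet> e j = (if i = j then 1 else 0)) \<and> span (e ` {..<d}) = UNIV"

definition int_lattice :: "nat \<Rightarrow> (nat \<Rightarrow> 'v::real_inner) \<Rightarrow> 'v set" where
  "int_lattice d e = {v. \<forall>i<d. v \<bullet> e i \<in> \<int>}"

definition additive_group :: "'v::group_add set \<Rightarrow> 'v monoid" where
  "additive_group S = \<lparr>carrier = S, monoid.mult = (+), one = 0\<rparr>"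

definition vector_lie_group :: "('v::real_normed_vector, 'v) lie_group" where
  "vector_lie_group =
     \<lparr>carrier = UNIV, monoid.mult = (+), one = 0, topol = euclidean, atlas = {(UNIV, id)}\<rparr>"

section \<open>Left-invariant Riemannian metrics\<close>

(* g c x v w is the inner product at x of the tangent vectors whose coordinates in the chart c
   are v and w. *)
type_synonym ('g, 'm) metric_tensor = "('g, 'm) chart \<Rightarrow> 'g \<Rightarrow> 'm \<Rightarrow> 'm \<Rightarrow> real"

definition riemannian_metric ::
  "('g, 'm::real_normed_vector) lie_group \<Rightarrow> ('g, 'm) metric_tensor \<Rightarrow> bool" where
  "riemannian_metric G g \<longleftrightarrow>
     (\<forall>(U, \<phi>)\<in>atlas G.
        (\<forall>x\<in>U. bilinear (g (U, \<phi>) x) \<and>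
           (\<forall>v w. g (U, \<phi>) x v w = g (U, \<phi>) x w v) \<and> (\<forall>v. v \<noteq> 0 \<longrightarrow> g (U, \<phi>) x v v > 0)) \<and>
        (\<forall>v w. smooth_on (\<lambda>p. g (U, \<phi>) (inv_into U \<phi> p) v w) (\<phi> ` U))) \<and>
     (\<forall>(U, \<phi>)\<in>atlas G. \<forall>(V, \<psi>)\<in>atlas G. \<forall>x\<in>U \<inter> V. \<forall>v w.
        let D = frechet_derivative (\<psi> \<circ> inv_into U \<phi>) (at (\<phi> x))
        in g (V, \<psi>) x (D v) (D w) = g (U, \<phi>) x v w)"

definition left_invariant ::
  "('g, 'm::real_normed_vector) lie_group \<Rightarrow> ('g, 'm) metric_tensor \<Rightarrow> bool" where
  "left_invariant G g \<longleftrightarrow>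
     (\<forall>a\<in>carrier G. \<forall>(U, \<phi>)\<in>atlas G. \<forall>(V, \<psi>)\<in>atlas G. \<forall>x\<in>U. a \<otimes>\<^bsub>G\<^esub> x \<in> V \<longrightarrow>
        (\<forall>v w.
          let D = frechet_derivative (\<psi> \<circ> (\<lambda>y. a \<otimes>\<^bsub>G\<^esub> y) \<circ> inv_into U \<phi>) (at (\<phi> x))
          in g (V, \<psi>) (a \<otimes>\<^bsub>G\<^esub> x) (D v) (D w) = g (U, \<phi>) x v w))"

(* Away from the finite set S of break points, every coordinate expression of the curve is C^1,
   with one-sided derivatives at the ends of each closed piece.  The library's
   piecewise_C1_differentiable_on does not bound the derivative near break points. *)
definition piecewise_C1_curve ::
  "('g, 'm::real_normed_vector) lie_group \<Rightarrow> (real \<Rightarrow> 'g) \<Rightarrow> bool" where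
  "piecewise_C1_curve G \<gamma> \<longleftrightarrow> pathin (topol G) \<gamma> \<and>
     (\<exists>S. finite S \<and>
        (\<forall>(U, \<phi>)\<in>atlas G. \<forall>s t.
           0 \<le> s \<and> s < t \<and> t \<le> 1 \<and> {s<..<t} \<inter> S = {} \<and> \<gamma> ` {s..t} \<subseteq> U \<longrightarrow>
           (\<exists>D. continuous_on {s..t} D \<and>
              (\<forall>r\<in>{s..t}. ((\<phi> \<circ> \<gamma>) has_vector_derivative D r) (at r within {s..t})))))"

(* Independent of the chosen chart by the compatibility condition in riemannian_metric; the
   value at the finitely many break points is irrelevant for the length. *)
definition curve_speed ::
  "('g, 'm::real_normed_vector) lie_group \<Rightarrow> ('g, 'm) metric_tensor \<Rightarrow> (real \<Rightarrow> 'g) \<Rightarrow> real \<Rightarrow> real"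
  where
  "curve_speed G g \<gamma> t =
     (let c = (SOME c. c \<in> atlas G \<and> \<gamma> t \<in> fst c);
          v = vector_derivative (snd c \<circ> \<gamma>) (at t within {0..1})
      in sqrt (g c (\<gamma> t) v v))"

definition riemannian_dist ::
  "('g, 'm::real_normed_vector) lie_group \<Rightarrow> ('g, 'm) metric_tensor \<Rightarrow> 'g \<Rightarrow> 'g \<Rightarrow> real" where
  "riemannian_dist G g x y =
     Inf {integral {0..1} (curve_speed G g \<gamma>) |\<gamma>. piecewise_C1_curve G \<gamma> \<and> \<gamma> 0 = x \<and> \<gamma> 1 = y}"

section \<open>Uniform lattices, word metrics and quasi-isometries\<close>

definition left_coset_space :: "('g, 'm) lie_group \<Rightarrow> 'g set \<Rightarrow> 'g set topology" where
  "left_coset_space G N =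
     topology (\<lambda>\<U>. \<U> \<subseteq> (\<lambda>a. a <#\<^bsub>G\<^esub> N) ` carrier G \<and>
                   openin (topol G) {a \<in> carrier G. a <#\<^bsub>G\<^esub> N \<in> \<U>})"

definition uniform_lattice :: "('g, 'm) lie_group \<Rightarrow> 'g set \<Rightarrow> bool" where
  "uniform_lattice G N \<longleftrightarrow> subgroup N G \<and>
     subtopology (topol G) N = discrete_topology N \<and> compact_space (left_coset_space G N)"

definition word_length :: "('a, 'b) monoid_scheme \<Rightarrow> 'a set \<Rightarrow> 'a \<Rightarrow> nat" where
  "word_length G S x =
     (LEAST n. \<exists>w. length w = n \<and> set w \<subseteq> S \<union> (\<lambda>s. inv\<^bsub>G\<^esub> s) ` S \<and>
                   foldr (\<lambda>s y. s \<otimes>\<^bsub>G\<^esub> y) w \<one>\<^bsub>G\<^esub> = x)"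

definition word_dist :: "('a, 'b) monoid_scheme \<Rightarrow> 'a set \<Rightarrow> 'a \<Rightarrow> 'a \<Rightarrow> real" where
  "word_dist G S x y = real (word_length G S (inv\<^bsub>G\<^esub> x \<otimes>\<^bsub>G\<^esub> y))"

definition quasi_isometry ::
  "'a set \<Rightarrow> ('a \<Rightarrow> 'a \<Rightarrow> real) \<Rightarrow> 'b set \<Rightarrow> ('b \<Rightarrow> 'b \<Rightarrow> real) \<Rightarrow> ('a \<Rightarrow> 'b) \<Rightarrow> bool" where
  "quasi_isometry X dX Y dY f \<longleftrightarrow> f ` X \<subseteq> Y \<and>
     (\<exists>K\<ge>1. \<exists>C\<ge>0.
        (\<forall>x\<in>X. \<forall>x'\<in>X. dX x x' / K - C \<le> dY (f x) (f x') \<and> dY (f x) (f x') \<le> K * dX x x' + C) \<and>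
        (\<forall>y\<in>Y. \<exists>x\<in>X. dY (f x) y \<le> C))"

section \<open>The real Abelianization\<close>

definition abelianization :: "('a, 'b) monoid_scheme \<Rightarrow> 'a set monoid" where
  "abelianization K = K Mod derived K (carrier K)"

definition abelianization_map :: "('a, 'b) monoid_scheme \<Rightarrow> 'a \<Rightarrow> 'a set" where
  "abelianization_map K x = derived K (carrier K) #>\<^bsub>K\<^esub> x"

definition agrees_with_abelianization ::
  "('a, 'b) monoid_scheme \<Rightarrow> nat \<Rightarrow> (nat \<Rightarrow> 'v::real_inner) \<Rightarrow> ('a \<Rightarrow> 'v) \<Rightarrow> bool" where
  "agrees_with_abelianization K d e \<theta> \<longleftrightarrow>
     (let Z = additive_group (int_lattice d e) in
      \<exists>\<iota>\<in>iso (abelianization K) Z. \<exists>\<sigma>\<in>iso Z Z.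
        \<forall>x\<in>carrier K. \<theta> x = \<sigma> (\<iota> (abelianization_map K x)))"

(* Tensor product over the integers of two Abelian groups (written multiplicatively): the free
   Abelian group on pairs modulo biadditivity. *)
definition tensor_relations ::
  "('a, 'c) monoid_scheme \<Rightarrow> ('b, 'd) monoid_scheme \<Rightarrow> ('a \<times> 'b \<Rightarrow>\<^sub>0 int) set" where
  "tensor_relations A B =
     generate (free_Abelian_group (carrier A \<times> carrier B))
       ({frag_of (a \<otimes>\<^bsub>A\<^esub> a', b) - frag_of (a, b) - frag_of (a', b) |a a' b.
           a \<in> carrier A \<and> a' \<in> carrier A \<and> b \<in> carrier B} \<union>
        {frag_of (a, b \<otimes>\<^bsub>B\<^esub> b') - frag_of (a, b) - frag_of (a, b') |a b b'.
           a \<in> carrier A \<and> b \<in> carrier B \<and> b' \<in> carrier B})"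

definition tensor_product ::
  "('a, 'c) monoid_scheme \<Rightarrow> ('b, 'd) monoid_scheme \<Rightarrow> ('a \<times> 'b \<Rightarrow>\<^sub>0 int) set monoid" where
  "tensor_product A B = free_Abelian_group (carrier A \<times> carrier B) Mod tensor_relations A B"

definition pure_tensor ::
  "('a, 'c) monoid_scheme \<Rightarrow> ('b, 'd) monoid_scheme \<Rightarrow> 'a \<Rightarrow> 'b \<Rightarrow> ('a \<times> 'b \<Rightarrow>\<^sub>0 int) set" where
  "pure_tensor A B a b =
     tensor_relations A B #>\<^bsub>free_Abelian_group (carrier A \<times> carrier B)\<^esub> frag_of (a, b)"

abbreviation real_group :: "real monoid" where
  "real_group \<equiv> additive_group UNIV"

abbreviation real_tensor :: "('a, 'c) monoid_scheme \<Rightarrow> ('a \<times> real \<Rightarrow>\<^sub>0 int) set monoid" where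
  "real_tensor A \<equiv> tensor_product A real_group"

(* Multiplication by r on the second tensor factor, on cosets. *)
definition real_tensor_scale ::
  "('a, 'c) monoid_scheme \<Rightarrow> real \<Rightarrow> ('a \<times> real \<Rightarrow>\<^sub>0 int) set \<Rightarrow> ('a \<times> real \<Rightarrow>\<^sub>0 int) set" where
  "real_tensor_scale A r C =
     (\<Union>c\<in>C. tensor_relations A real_group
              #>\<^bsub>free_Abelian_group (carrier A \<times> carrier real_group)\<^esub>
              frag_extend (\<lambda>(a, s). frag_of (a, r * s)) c)"

definition norm_on_real_tensor ::
  "('a, 'c) monoid_scheme \<Rightarrow> (('a \<times> real \<Rightarrow>\<^sub>0 int) set \<Rightarrow> real) \<Rightarrow> bool" where
  "norm_on_real_tensor A \<nu> \<longleftrightarrow>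
     (\<forall>u\<in>carrier (real_tensor A).
        \<nu> u \<ge> 0 \<and> (\<nu> u = 0 \<longleftrightarrow> u = \<one>\<^bsub>real_tensor A\<^esub>) \<and>
        (\<forall>r. \<nu> (real_tensor_scale A r u) = \<bar>r\<bar> * \<nu> u) \<and>
        (\<forall>w\<in>carrier (real_tensor A). \<nu> (u \<otimes>\<^bsub>real_tensor A\<^esub> w) \<le> \<nu> u + \<nu> w))"

(* The map $\pi_M$. *)
definition real_abelianization_map ::
  "('a, 'b) monoid_scheme \<Rightarrow> 'a \<Rightarrow> ('a set \<times> real \<Rightarrow>\<^sub>0 int) set" where
  "real_abelianization_map K x =
     pure_tensor (abelianization K) real_group (abelianization_map K x) 1"

definition bounded_abelian_defect ::
  "('a, 'c) monoid_scheme \<Rightarrow> ('b, 'd) monoid_scheme \<Rightarrow> (('b set \<times> real \<Rightarrow>\<^sub>0 int) set \<Rightarrow> real) \<Rightarrow>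
   ('a \<Rightarrow> 'b) \<Rightarrow> bool" where
  "bounded_abelian_defect N M \<nu> \<Psi> \<longleftrightarrow>
     (let T = real_tensor (abelianization M); \<pi> = real_abelianization_map M in
      bdd_above {\<nu> (\<pi> (\<Psi> (x \<otimes>\<^bsub>N\<^esub> y)) \<otimes>\<^bsub>T\<^esub> inv\<^bsub>T\<^esub> \<pi> (\<Psi> x) \<otimes>\<^bsub>T\<^esub> inv\<^bsub>T\<^esub> \<pi> (\<Psi> y)) |x y.
                   x \<in> carrier N \<and> y \<in> carrier N})"

end

theory Submission
  imports Defs
begin

text \<open>
  Left invariance makes the derivative of \<open>\<Theta>\<^sub>H\<close> bounded with respect to the metric, so \<open>\<Theta>\<^sub>H\<close> is Lipschitz.
  Hence \<open>\<Theta>\<^sub>H \<circ> \<Psi>\<close> is at bounded distance from the affine function \<open>L \<circ> \<Theta>\<^sub>G + b\<close> of a homomorphism,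
  and the elements \<open>m = \<Psi>(xy) \<Psi>(x)\<^sup>-\<^sup>1 \<Psi>(y)\<^sup>-\<^sup>1\<close> of \<open>M\<close> have images under \<open>\<Theta>\<^sub>H\<close> in a bounded, hence
  finite, part of \<open>\<int>\<^sup>d\<close>.  As \<open>\<Theta>\<^sub>H\<close> on \<open>M\<close> is the Abelianization up to isomorphism, \<open>\<pi>\<^sub>M m\<close> takes only
  finitely many values, so any real function of it is bounded.
\<close>

section \<open>Finite-dimensional normed spaces\<close>

text \<open>The Lipschitz estimate for \<open>\<Theta>\<^sub>H\<close> takes most of the work. The
  Riemannian distance is an infimum over piecewise C^1 curves that may cross many charts, so two
  things have to be built: some such curve between any two points (an infimum over the empty set
  says nothing), and a comparison of the increment of \<open>\<Theta>\<^sub>H\<close> along a curve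
  with its length. Both are local, inside one chart, and become global by the same bisection of
  [0,1], \<open>Bolzano\<close>. The model spaces are merely normed spaces with a finite spanning
  set, possibly of dimension 0, so the comparison of a norm with a positive definite form is carried
  out in coordinates over an arbitrary basis. In the final estimate the linear part \<open>L\<close>
  cancels because \<open>\<Theta>\<^sub>G\<close> is additive, while the translation
  \<open>b\<close> survives exactly once.\<close>

text \<open>Equivalence of norms by compactness: \<open>q\<close> attains a positive minimum on the
  l1-unit sphere of coordinate functions, and homogeneity extends the bound. No triangle inequality
  is asked of \<open>q\<close>, so it can be a norm as well as the square root of a quadratic
  form.\<close>

lemma coordinate_lower_bound:
  fixes q :: "'a::real_normed_vector \<Rightarrow> real"
  assumes B: "finite B" "independent B"
    and cont: "continuous_on UNIV (\<lambda>u. q (\<Sum>b\<in>B. u b *\<^sub>R b))"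
    and pos: "\<And>v. v \<noteq> 0 \<Longrightarrow> q v > 0"
    and hom: "\<And>r v. q (r *\<^sub>R v) = \<bar>r\<bar> * q v"
  shows "\<exists>c>0. \<forall>u. c * (\<Sum>b\<in>B. \<bar>u b\<bar>) \<le> q (\<Sum>b\<in>B. u b *\<^sub>R b)"
proof (cases "B = {}")
  case True
  then show ?thesis using hom[of 0 0] by (auto intro!: exI[of _ 1])
next
  case False
  \<comment> \<open>Coordinates outside \<open>B\<close> are pinned to 0, which makes
    \<open>P\<close> a product of compact sets over the whole index type, compact by
    Tychonoff.\<close>
  define P where "P = (\<Pi>\<^sub>E b\<in>UNIV. if b \<in> B then {-1..1::real} else {0})"
  define K where "K = P \<inter> {u. (\<Sum>b\<in>B. \<bar>u b\<bar>) = 1}"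
  have "compactin (product_topology (\<lambda>i. euclidean) UNIV) P"
    unfolding P_def compactin_PiE by auto
  then have "compact P"
    by (metis compactin_euclidean_iff euclidean_product_topology)
  moreover have "closed {u::'a \<Rightarrow> real. (\<Sum>b\<in>B. \<bar>u b\<bar>) = 1}"
    by (intro closed_Collect_eq continuous_intros continuous_on_product_coordinates)
  ultimately have "compact K"
    unfolding K_def by blast
  have in_K: "(\<lambda>b. if b \<in> B then u b / (\<Sum>b\<in>B. \<bar>u b\<bar>) else 0) \<in> K"
    if "(\<Sum>b\<in>B. \<bar>u b\<bar>) > 0" for u
  proof -
    have le: "\<bar>u b\<bar> \<le> (\<Sum>b\<in>B. \<bar>u b\<bar>)" if "b \<in> B" for b
      using B(1) that by (intro member_le_sum) auto
    let ?w = "\<lambda>b. if b \<in> B then u b / (\<Sum>b\<in>B. \<bar>u b\<bar>) else 0"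
    have "- 1 \<le> ?w b \<and> ?w b \<le> 1" if "b \<in> B" for b
      using le[OF that] \<open>(\<Sum>b\<in>B. \<bar>u b\<bar>) > 0\<close> that by (simp add: le_divide_eq abs_le_iff)
    then have "?w b \<in> (if b \<in> B then {-1..1} else {0})" for b
      by simp
    then have "?w \<in> P"
      unfolding P_def by blast
    moreover have "(\<Sum>b\<in>B. \<bar>?w b\<bar>) = (\<Sum>b\<in>B. \<bar>u b\<bar> / (\<Sum>b\<in>B. \<bar>u b\<bar>))"
      using that by (intro sum.cong) (auto simp: abs_divide)
    ultimately show ?thesis
      using that by (simp add: K_def flip: sum_divide_distrib)
  qed
  have sum1: "(\<Sum>b\<in>B. \<bar>1::real\<bar>) > 0"
    using B(1) False by (simp add: card_gt_0_iff)
  have "K \<noteq> {}"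
    using in_K[OF sum1] by blast
  then obtain u0 where u0: "u0 \<in> K" "\<And>u. u \<in> K \<Longrightarrow> q (\<Sum>b\<in>B. u0 b *\<^sub>R b) \<le> q (\<Sum>b\<in>B. u b *\<^sub>R b)"
    using continuous_attains_inf[OF \<open>compact K\<close> _ continuous_on_subset[OF cont subset_UNIV]]
    by blast
  let ?m = "q (\<Sum>b\<in>B. u0 b *\<^sub>R b)"
  have "(\<Sum>b\<in>B. u0 b *\<^sub>R b) \<noteq> 0"
  proof
    assume "(\<Sum>b\<in>B. u0 b *\<^sub>R b) = 0"
    then have "\<forall>b\<in>B. u0 b = 0"
      using independentD[OF B(2) B(1) order_refl] by blast
    then show False using u0(1) by (simp add: K_def)
  qed
  then have "?m > 0" by (rule pos)
  moreover have "?m * (\<Sum>b\<in>B. \<bar>u b\<bar>) \<le> q (\<Sum>b\<in>B. u b *\<^sub>R b)" for u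
  proof (cases "(\<Sum>b\<in>B. \<bar>u b\<bar>) > 0")
    case True
    let ?s = "\<Sum>b\<in>B. \<bar>u b\<bar>"
    have "(\<Sum>b\<in>B. (if b \<in> B then u b / ?s else 0) *\<^sub>R b) = (1 / ?s) *\<^sub>R (\<Sum>b\<in>B. u b *\<^sub>R b)"
      unfolding scaleR_sum_right by (intro sum.cong) auto
    then have "?m \<le> (1 / ?s) * q (\<Sum>b\<in>B. u b *\<^sub>R b)"
      using u0(2)[OF in_K[OF True]] True by (simp add: hom)
    then show ?thesis using True by (simp add: field_simps)
  next
    case False
    then have "(\<Sum>b\<in>B. \<bar>u b\<bar>) = 0"
      by (meson abs_ge_zero linorder_not_less order.antisym sum_nonneg)
    then show ?thesis
      using pos hom[of 0 0] by (metis abs_zero less_eq_real_def mult_zero_left mult_zero_right scaleR_zero_left)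
  qed
  ultimately show ?thesis by blast
qed

lemma finite_dim_basis:
  assumes "\<exists>B::'a::real_normed_vector set. finite B \<and> span B = UNIV"
  obtains B :: "'a::real_normed_vector set" where "finite B" "independent B" "span B = UNIV"
proof -
  obtain B0 :: "'a set" where B0: "finite B0" "span B0 = UNIV" using assms by blast
  obtain B where "B \<subseteq> B0" "independent B" "B0 \<subseteq> span B"
    using maximal_independent_subset by blast
  then show ?thesis
    using B0 that by (metis UNIV_I finite_subset span_minimal span_eq subset_antisym subset_UNIV subspace_span)
qed

lemma sum_representation:
  assumes "finite B" "independent B" "span B = UNIV"
  shows "(\<Sum>b\<in>B. representation B v b *\<^sub>R b) = v"
  using assms by (intro sum_representation_eq) auto

text \<open>Apply the lower bound with \<open>q = norm\<close>: a single coordinate is at most the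
  l1-sum of all of them. Continuity can then be checked in coordinates.\<close>

lemma bounded_linear_representation:
  fixes B :: "'a::real_normed_vector set"
  assumes B: "finite B" "independent B" "span B = UNIV"
  shows "bounded_linear (\<lambda>v. representation B v b)"
proof -
  have "\<exists>c>0. \<forall>u. c * (\<Sum>b\<in>B. \<bar>u b\<bar>) \<le> norm (\<Sum>b\<in>B. u b *\<^sub>R b)"
    using B by (intro coordinate_lower_bound continuous_intros continuous_on_product_coordinates) auto
  then obtain c where c: "c > 0" "\<And>u. c * (\<Sum>b\<in>B. \<bar>u b\<bar>) \<le> norm (\<Sum>b\<in>B. u b *\<^sub>R b)"
    by blast
  show ?thesis
  proof (intro bounded_linear_intro[where K = "1 / c"])
    fix v w :: 'a and r :: real
    show "representation B (v + w) b = representation B v b + representation B w b"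
      "representation B (r *\<^sub>R v) b = r *\<^sub>R representation B v b"
      by (simp_all add: representation_add[OF B(2)] representation_scale[OF B(2)] B(3))
    show "norm (representation B v b) \<le> norm v * (1 / c)"
    proof (cases "b \<in> B")
      case True
      have "c * \<bar>representation B v b\<bar> \<le> c * (\<Sum>b\<in>B. \<bar>representation B v b\<bar>)"
        using c(1) B(1) True by (intro mult_left_mono member_le_sum) auto
      also have "\<dots> \<le> norm v"
        using c(2)[of "representation B v"] sum_representation[OF B, of v] by simp
      finally show ?thesis using c(1) by (simp add: field_simps)
    next
      case False
      then have "representation B v b = 0"
        using representation_ne_zero by blast
      then show ?thesis using c(1) by simp
    qed
  qed
qed

text \<open>A metric tensor is known to be continuous only for fixed pairs of vectors. Expanding
  \<open>D t\<close> in a basis reduces the moving argument to finitely many such pairs. With a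
  constant \<open>g\<close> it also gives continuity of a quadratic form in the coordinates.\<close>

lemma continuous_on_bilinear_diag:
  fixes g :: "'t::topological_space \<Rightarrow> 'a::real_normed_vector \<Rightarrow> 'a \<Rightarrow> real"
  assumes fd: "\<exists>B::'a set. finite B \<and> span B = UNIV"
    and bil: "\<And>t. t \<in> T \<Longrightarrow> bilinear (g t)"
    and g: "\<And>v w. continuous_on T (\<lambda>t. g t v w)"
    and D: "continuous_on T D"
  shows "continuous_on T (\<lambda>t. g t (D t) (D t))"
proof -
  obtain B :: "'a set" where B: "finite B" "independent B" "span B = UNIV"
    using fd by (rule finite_dim_basis)
  have "g t (D t) (D t) =
      (\<Sum>(b, b')\<in>B \<times> B. representation B (D t) b * representation B (D t) b' * g t b b')"
    if "t \<in> T" for t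
  proof -
    have "g t (\<Sum>b\<in>B. representation B (D t) b *\<^sub>R b)
        (\<Sum>b\<in>B. representation B (D t) b *\<^sub>R b) = (\<Sum>(b, b')\<in>B \<times> B.
        g t (representation B (D t) b *\<^sub>R b) (representation B (D t) b' *\<^sub>R b'))"
      by (rule bilinear_sum[OF bil[OF that]])
    then show ?thesis
      using bil[OF that] unfolding sum_representation[OF B]
      by (simp add: bilinear_lmul[OF bil[OF that]] bilinear_rmul[OF bil[OF that]] mult_ac)
  qed
  moreover have cont: "continuous_on T (\<lambda>t. \<Sum>(b, b')\<in>B \<times> B.
      representation B (D t) b * representation B (D t) b' * g t b b')"
    unfolding case_prod_beta
    by (intro continuous_intros g bounded_linear.continuous_on[OF bounded_linear_representation[OF B]] D)
  ultimately show ?thesis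
    using continuous_on_eq[OF cont] by simp
qed

text \<open>A positive definite form dominates the l1-size of the coordinates, and that size
  controls any linear map. This is the bound for the differential of a homomorphism at the
  identity.\<close>

lemma linear_le_sqrt_form:
  fixes g :: "'a::real_normed_vector \<Rightarrow> 'a \<Rightarrow> real" and A :: "'a \<Rightarrow> 'b::real_normed_vector"
  assumes fd: "\<exists>B::'a set. finite B \<and> span B = UNIV"
    and bil: "bilinear g" and pos: "\<And>v. v \<noteq> 0 \<Longrightarrow> g v v > 0" and A: "linear A"
  shows "\<exists>C\<ge>0. \<forall>v. norm (A v) \<le> C * sqrt (g v v)"
proof -
  obtain B :: "'a set" where B: "finite B" "independent B" "span B = UNIV"
    using fd by (rule finite_dim_basis)
  have "\<exists>c>0. \<forall>u. c * (\<Sum>b\<in>B. \<bar>u b\<bar>) \<le> sqrt (g (\<Sum>b\<in>B. u b *\<^sub>R b) (\<Sum>b\<in>B. u b *\<^sub>R b))"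
  proof (rule coordinate_lower_bound[OF B(1,2), where q = "\<lambda>v. sqrt (g v v)"])
    show "continuous_on UNIV (\<lambda>u. sqrt (g (\<Sum>b\<in>B. u b *\<^sub>R b) (\<Sum>b\<in>B. u b *\<^sub>R b)))"
      by (intro continuous_on_real_sqrt
          continuous_on_bilinear_diag[OF fd, where g = "\<lambda>_. g", OF bil continuous_on_const]
          continuous_on_sum continuous_on_scaleR continuous_on_const continuous_on_product_coordinates)
    show "sqrt (g (r *\<^sub>R v) (r *\<^sub>R v)) = \<bar>r\<bar> * sqrt (g v v)" for r v
      by (simp only: bilinear_lmul[OF bil] bilinear_rmul[OF bil] real_scaleR_def mult.assoc[symmetric])
        (simp only: real_sqrt_mult[of "r * r"] real_sqrt_abs2)
  qed (simp add: pos)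
  then obtain c where c: "c > 0"
    "\<And>u. c * (\<Sum>b\<in>B. \<bar>u b\<bar>) \<le> sqrt (g (\<Sum>b\<in>B. u b *\<^sub>R b) (\<Sum>b\<in>B. u b *\<^sub>R b))"
    by blast
  \<comment> \<open>A sum instead of a maximum: it dominates every \<open>norm (A b)\<close> and
    still makes sense for the empty basis of dimension 0.\<close>
  define M where "M = (\<Sum>b\<in>B. norm (A b))"
  have "norm (A v) \<le> (M / c) * sqrt (g v v)" for v
  proof -
    let ?u = "representation B v"
    have "A v = (\<Sum>b\<in>B. ?u b *\<^sub>R A b)"
      using A by (subst sum_representation[OF B, of v, symmetric]) (simp add: linear_sum linear_scale)
    then have "norm (A v) \<le> (\<Sum>b\<in>B. \<bar>?u b\<bar> * norm (A b))"
      by (simp add: sum_norm_le)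
    also have "\<dots> \<le> (\<Sum>b\<in>B. \<bar>?u b\<bar> * M)"
      using B(1) by (intro sum_mono mult_left_mono) (auto simp: M_def intro: member_le_sum)
    also have "\<dots> = (M / c) * (c * (\<Sum>b\<in>B. \<bar>?u b\<bar>))"
      using c(1) by (simp add: sum_distrib_left mult.commute)
    also have "\<dots> \<le> (M / c) * sqrt (g v v)"
      using c sum_representation[OF B, of v]
      by (intro mult_left_mono) (metis, auto simp: M_def sum_nonneg)
    finally show ?thesis .
  qed
  moreover have "M / c \<ge> 0" using c(1) by (simp add: M_def sum_nonneg)
  ultimately show ?thesis by blast
qed

section \<open>Charts and smooth maps\<close>

lemma smooth_on_imp_has_derivative:
  assumes "smooth_on f S" "x \<in> S"
  shows "(f has_derivative frechet_derivative f (at x)) (at x)"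
proof -
  have "Ck_on (Suc 0) f S" using assms(1) unfolding smooth_on_def by blast
  then show ?thesis using assms(2) by (simp add: frechet_derivative_works)
qed

lemma smooth_on_imp_continuous_derivative:
  assumes "smooth_on f S"
  shows "continuous_on S (\<lambda>x. frechet_derivative f (at x) v)"
proof -
  have "Ck_on (Suc 0) f S" using assms(1) unfolding smooth_on_def by blast
  then show ?thesis by simp
qed

lemma smooth_on_imp_continuous_on:
  assumes "smooth_on f S"
  shows "continuous_on S f"
proof -
  have "Ck_on 0 f S" using assms(1) unfolding smooth_on_def by blast
  then show ?thesis by simp
qed

context
  fixes X :: "'g topology" and A :: "('g, 'm::real_normed_vector) chart set" and U \<phi>
  assumes X: "smooth_manifold X A" and c: "(U, \<phi>) \<in> A"
begin

lemma chart_domain_open: "openin X U"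
  and chart_homeomorphic: "homeomorphic_map (subtopology X U) (top_of_set (\<phi> ` U)) \<phi>"
  and chart_range_open: "open (\<phi> ` U)"
  using X c unfolding smooth_manifold_def by auto

lemma chart_topspace: "topspace (subtopology X U) = U"
  using openin_subset[OF chart_domain_open] by auto

lemma chart_inj: "inj_on \<phi> U"
  using homeomorphic_imp_injective_map[OF chart_homeomorphic] unfolding chart_topspace .

lemma chart_continuous: "continuous_map (subtopology X U) euclidean \<phi>"
  using homeomorphic_imp_continuous_map[OF chart_homeomorphic] continuous_map_in_subtopology by blast

lemma chart_image_open:
  assumes "openin X W" "W \<subseteq> U"
  shows "open (\<phi> ` W)"
proof -
  have "openin (subtopology X U) W"
    using assms chart_domain_open by (simp add: openin_open_subtopology)
  then have "openin (top_of_set (\<phi> ` U)) (\<phi> ` W)"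
    using homeomorphic_imp_open_map[OF chart_homeomorphic] by (simp add: open_map_def)
  then show ?thesis
    using chart_range_open by (rule openin_open_trans)
qed

lemma chart_preimage_open:
  assumes "open W"
  shows "openin X {x \<in> U. \<phi> x \<in> W}"
proof -
  have "openin (subtopology X U) {x \<in> U. \<phi> x \<in> W}"
    using openin_continuous_map_preimage[OF chart_continuous, of W] assms unfolding chart_topspace by simp
  then show ?thesis
    using chart_domain_open by (rule openin_trans_full)
qed

lemma chart_inverse_continuous: "continuous_map (top_of_set (\<phi> ` U)) X (inv_into U \<phi>)"
proof -
  obtain f where f: "homeomorphic_maps (subtopology X U) (top_of_set (\<phi> ` U)) \<phi> f"
    using chart_homeomorphic homeomorphic_map_maps by blast
  have "continuous_map (top_of_set (\<phi> ` U)) X f"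
    using f continuous_map_in_subtopology unfolding homeomorphic_maps_def by blast
  moreover have "f p = inv_into U \<phi> p" if "p \<in> \<phi> ` U" for p
    using f that chart_inj unfolding homeomorphic_maps_def chart_topspace by auto
  ultimately show ?thesis
    by (rule continuous_map_eq) simp
qed

lemma chart_transition_smooth:
  assumes "(V, \<psi>) \<in> A"
  shows "smooth_on (\<psi> \<circ> inv_into U \<phi>) (\<phi> ` (U \<inter> V))"
proof -
  have "\<forall>(U, \<phi>)\<in>A. \<forall>(V, \<psi>)\<in>A. smooth_on (\<psi> \<circ> inv_into U \<phi>) (\<phi> ` (U \<inter> V))"
    using X unfolding smooth_manifold_def by blast
  from bspec[OF this c] assms show ?thesis by auto
qed

end

text \<open>Chain rule for \<open>f \<circ> \<gamma>\<close> factored through the chart, which is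
  legitimate because the curve stays in \<open>U\<close>. Here \<open>f\<close> will be another
  chart or a homomorphism to a vector group.\<close>

lemma vector_derivative_through_chart:
  assumes "inj_on \<phi> U" "\<gamma> ` T \<subseteq> U" "t \<in> T"
    and "((\<phi> \<circ> \<gamma>) has_vector_derivative D) (at t within T)"
    and F: "((f \<circ> inv_into U \<phi>) has_derivative F) (at (\<phi> (\<gamma> t)))"
  shows "((f \<circ> \<gamma>) has_vector_derivative F D) (at t within T)"
proof -
  have "(((f \<circ> inv_into U \<phi>) \<circ> (\<phi> \<circ> \<gamma>)) has_derivative F \<circ> (\<lambda>r. r *\<^sub>R D)) (at t within T)"
    using assms(4) F by (intro diff_chain_within)
      (auto simp: has_vector_derivative_def intro: has_derivative_at_withinI)
  moreover have "F \<circ> (\<lambda>r. r *\<^sub>R D) = (\<lambda>r. r *\<^sub>R F D)"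
    using linear_scale[OF has_derivative_linear[OF F]] by auto
  ultimately have "(((f \<circ> inv_into U \<phi>) \<circ> (\<phi> \<circ> \<gamma>)) has_vector_derivative F D) (at t within T)"
    by (simp add: has_vector_derivative_def)
  then show ?thesis
    using assms(1-3) by (elim has_vector_derivative_transform[rotated 2]) (auto simp: image_subset_iff)
qed

section \<open>Piecewise continuously differentiable curves\<close>

text \<open>Supplies the radius needed in the local step of both bisections.\<close>

lemma pathin_local:
  assumes "pathin X p" "openin X W" "x \<in> {0..1}" "p x \<in> W"
  shows "\<exists>d>0. \<forall>r\<in>{0..1}. \<bar>r - x\<bar> < d \<longrightarrow> p r \<in> W"
proof -
  have "openin (top_of_set {0..1}) {r \<in> {0..1}. p r \<in> W}"
    using openin_continuous_map_preimage assms(1,2) unfolding pathin_def by fastforce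
  then show ?thesis
    using assms(3,4) unfolding openin_euclidean_subtopology_iff by (auto simp: dist_real_def)
qed

context
  fixes G :: "('g, 'm::real_normed_vector) lie_group"
  assumes G: "smooth_manifold (topol G) (atlas G)"
begin

text \<open>Pull a straight segment back through one chart. In any other chart its derivative is the
  differential of the transition map applied to \<open>q - p\<close>, continuous by smoothness, so
  there are no break points.\<close>

lemma chart_segment_curve:
  assumes V: "(V, \<psi>) \<in> atlas G" and seg: "closed_segment p q \<subseteq> \<psi> ` V"
  shows "\<exists>\<gamma>. piecewise_C1_curve G \<gamma> \<and> \<gamma> 0 = inv_into V \<psi> p \<and> \<gamma> 1 = inv_into V \<psi> q"
proof -
  define \<gamma> where "\<gamma> = inv_into V \<psi> \<circ> linepath p q"
  have l: "linepath p q r \<in> \<psi> ` V" if "r \<in> {0..1}" for r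
    using seg that by (metis image_eqI linepath_image_01 subsetD)
  have "continuous_map (top_of_set {0..1}) (top_of_set (\<psi> ` V)) (linepath p q)"
    using l by (auto simp: continuous_map_in_subtopology)
  then have "pathin (topol G) \<gamma>"
    unfolding pathin_def \<gamma>_def
    by (rule continuous_map_compose[OF _ chart_inverse_continuous[OF G V]])
  moreover have "\<exists>D. continuous_on {s..t} D \<and>
      (\<forall>r\<in>{s..t}. ((\<phi> \<circ> \<gamma>) has_vector_derivative D r) (at r within {s..t}))"
    if U: "(U, \<phi>) \<in> atlas G" and st: "0 \<le> s" "t \<le> 1" "\<gamma> ` {s..t} \<subseteq> U" for U \<phi> s t
  proof -
    let ?F = "\<phi> \<circ> inv_into V \<psi>"
    have smooth: "smooth_on ?F (\<psi> ` (V \<inter> U))"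
      by (rule chart_transition_smooth[OF G V U])
    have mem: "linepath p q r \<in> \<psi> ` (V \<inter> U)" if "r \<in> {s..t}" for r
    proof
      have r: "linepath p q r \<in> \<psi> ` V" using l that st by simp
      then show "linepath p q r = \<psi> (\<gamma> r)" by (simp add: \<gamma>_def f_inv_into_f)
      show "\<gamma> r \<in> V \<inter> U"
        using inv_into_into[OF r] st(3) that by (auto simp only: \<gamma>_def o_apply)
    qed
    have "continuous_on {s..t} (\<lambda>r. frechet_derivative ?F (at (linepath p q r)) (q - p))"
      using mem by (intro continuous_on_compose2[OF smooth_on_imp_continuous_derivative[OF smooth]]
          continuous_on_linepath) auto
    moreover have "((\<phi> \<circ> \<gamma>) has_vector_derivative
        frechet_derivative ?F (at (linepath p q r)) (q - p)) (at r within {s..t})"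
      if "r \<in> {s..t}" for r
    proof -
      have "((?F \<circ> linepath p q) has_vector_derivative
          frechet_derivative ?F (at (linepath p q r)) (q - p)) (at r within {s..t})"
        by (rule vector_derivative_diff_chain_within[OF has_vector_derivative_linepath_within])
          (rule has_derivative_at_withinI[OF smooth_on_imp_has_derivative[OF smooth mem[OF that]]])
      then show ?thesis by (simp add: \<gamma>_def o_assoc)
    qed
    ultimately show ?thesis by blast
  qed
  ultimately have "piecewise_C1_curve G \<gamma>"
    unfolding piecewise_C1_curve_def by (auto intro!: exI[of _ "{}"])
  then show ?thesis
    by (auto simp: \<gamma>_def linepath_def)
qed

end

text \<open>The library's \<open>joinpaths\<close> is confined to types of class \<open>topological_space\<close>.\<close>

definition curve_join :: "(real \<Rightarrow> 'a) \<Rightarrow> (real \<Rightarrow> 'a) \<Rightarrow> real \<Rightarrow> 'a" where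
  "curve_join p q r = (if r \<le> 1 / 2 then p (2 * r) else q (2 * r - 1))"

lemma pathin_curve_join:
  assumes "pathin X p" "pathin X q" "p 1 = q 0"
  shows "pathin X (curve_join p q)"
  unfolding pathin_def curve_join_def[abs_def]
proof (rule continuous_map_cases_le)
  have sub: "subtopology (top_of_set {0..1}) T = top_of_set ({0..1} \<inter> T)" for T :: "real set"
    by (simp add: subtopology_subtopology)
  show "continuous_map (subtopology (top_of_set {0..1}) {x \<in> topspace (top_of_set {0..1}). x \<le> 1 / 2}) X (\<lambda>x. p (2 * x))"
    unfolding sub
    by (rule continuous_map_compose[OF _ assms(1)[unfolded pathin_def], unfolded o_def])
      (auto simp: continuous_map_in_subtopology intro!: continuous_intros)
  show "continuous_map (subtopology (top_of_set {0..1}) {x \<in> topspace (top_of_set {0..1}). 1 / 2 \<le> x}) X (\<lambda>x. q (2 * x - 1))"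
    unfolding sub
    by (rule continuous_map_compose[OF _ assms(2)[unfolded pathin_def], unfolded o_def])
      (auto simp: continuous_map_in_subtopology intro!: continuous_intros)
  show "p (2 * x) = q (2 * x - 1)" if "x = 1 / 2" for x :: real
    unfolding that using assms(3) by simp
qed auto

lemma has_vector_derivative_affine_reparam:
  fixes f :: "real \<Rightarrow> 'a::real_normed_vector"
  assumes "(f has_vector_derivative D) (at (m * r + c) within (\<lambda>x. m * x + c) ` T)"
  shows "((\<lambda>x. f (m * x + c)) has_vector_derivative m *\<^sub>R D) (at r within T)"
proof -
  have "((\<lambda>x. m * x + c) has_vector_derivative m) (at r within T)"
    by (auto intro!: derivative_eq_intros simp: has_vector_derivative_def)
  from vector_diff_chain_within[OF this assms] show ?thesis by (simp add: o_def)
qed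

text \<open>Serves both halves of \<open>curve_join\<close>, with \<open>m = 2\<close> and
  \<open>c = 0\<close> or \<open>c = -1\<close>: an increasing affine change of parameter respects
  break-free intervals and multiplies the derivative by \<open>m\<close>.\<close>

lemma piecewise_C1_curve_affine_piece:
  assumes S: "\<forall>(U, \<phi>)\<in>atlas G. \<forall>s t.
           0 \<le> s \<and> s < t \<and> t \<le> 1 \<and> {s<..<t} \<inter> S = {} \<and> \<gamma> ` {s..t} \<subseteq> U \<longrightarrow>
           (\<exists>D. continuous_on {s..t} D \<and>
              (\<forall>r\<in>{s..t}. ((\<phi> \<circ> \<gamma>) has_vector_derivative D r) (at r within {s..t})))"
    and U: "(U, \<phi>) \<in> atlas G" and m: "m > 0" and st: "s < t"
    and bounds: "0 \<le> m * s + c" "m * t + c \<le> 1"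
    and disj: "\<And>r. r \<in> {s<..<t} \<Longrightarrow> m * r + c \<notin> S"
    and eq: "\<And>r. r \<in> {s..t} \<Longrightarrow> \<delta> r = \<gamma> (m * r + c)" and sub: "\<delta> ` {s..t} \<subseteq> U"
  shows "\<exists>D. continuous_on {s..t} D \<and>
      (\<forall>r\<in>{s..t}. ((\<phi> \<circ> \<delta>) has_vector_derivative D r) (at r within {s..t}))"
proof -
  have img: "(\<lambda>x. m * x + c) ` {s..t} = {m * s + c..m * t + c}"
    using m st by (simp add: image_affinity_atLeastAtMost)
  have img': "(\<lambda>x. m * x + c) ` {s<..<t} = {m * s + c<..<m * t + c}"
  proof (intro equalityI subsetI)
    fix y assume "y \<in> {m * s + c<..<m * t + c}"
    then have "y = m * ((y - c) / m) + c \<and> (y - c) / m \<in> {s<..<t}"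
      using m by (auto simp: field_simps)
    then show "y \<in> (\<lambda>x. m * x + c) ` {s<..<t}" by blast
  qed (use m in auto)
  have "{m * s + c<..<m * t + c} \<inter> S = {}"
    using disj unfolding img'[symmetric] by blast
  moreover have "\<gamma> ` {m * s + c..m * t + c} \<subseteq> U"
    using sub eq unfolding img[symmetric] by auto
  moreover have "m * s + c < m * t + c"
    using mult_strict_left_mono[OF st m] by simp
  moreover note bspec[OF S U, unfolded prod.case, rule_format, of "m * s + c" "m * t + c"] bounds
  ultimately obtain D where D: "continuous_on {m * s + c..m * t + c} D"
    "\<And>r. r \<in> {m * s + c..m * t + c} \<Longrightarrow>
      ((\<phi> \<circ> \<gamma>) has_vector_derivative D r) (at r within {m * s + c..m * t + c})"
    by blast
  have "continuous_on {s..t} (\<lambda>r. m *\<^sub>R D (m * r + c))"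
    using m by (intro continuous_intros continuous_on_compose2[OF D(1)]) auto
  moreover have "((\<phi> \<circ> \<delta>) has_vector_derivative m *\<^sub>R D (m * r + c)) (at r within {s..t})"
    if r: "r \<in> {s..t}" for r
  proof -
    have "((\<lambda>x. (\<phi> \<circ> \<gamma>) (m * x + c)) has_vector_derivative m *\<^sub>R D (m * r + c)) (at r within {s..t})"
      using r m by (intro has_vector_derivative_affine_reparam) (auto simp only: img intro!: D(2), auto)
    then show ?thesis
      using r eq by (elim has_vector_derivative_transform[rotated 2]) auto
  qed
  ultimately show ?thesis by blast
qed

lemma piecewise_C1_curve_join:
  assumes "piecewise_C1_curve G \<gamma>1" "piecewise_C1_curve G \<gamma>2" "\<gamma>1 1 = \<gamma>2 0"
  shows "piecewise_C1_curve G (curve_join \<gamma>1 \<gamma>2)"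
proof -
  obtain S1 where S1: "finite S1" "\<forall>(U, \<phi>)\<in>atlas G. \<forall>s t.
           0 \<le> s \<and> s < t \<and> t \<le> 1 \<and> {s<..<t} \<inter> S1 = {} \<and> \<gamma>1 ` {s..t} \<subseteq> U \<longrightarrow>
           (\<exists>D. continuous_on {s..t} D \<and>
              (\<forall>r\<in>{s..t}. ((\<phi> \<circ> \<gamma>1) has_vector_derivative D r) (at r within {s..t})))"
    using assms(1) unfolding piecewise_C1_curve_def by blast
  obtain S2 where S2: "finite S2" "\<forall>(U, \<phi>)\<in>atlas G. \<forall>s t.
           0 \<le> s \<and> s < t \<and> t \<le> 1 \<and> {s<..<t} \<inter> S2 = {} \<and> \<gamma>2 ` {s..t} \<subseteq> U \<longrightarrow>
           (\<exists>D. continuous_on {s..t} D \<and>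
              (\<forall>r\<in>{s..t}. ((\<phi> \<circ> \<gamma>2) has_vector_derivative D r) (at r within {s..t})))"
    using assms(2) unfolding piecewise_C1_curve_def by blast
  \<comment> \<open>The seam, together with the preimages of the old break points under
    \<open>2 * r\<close> and \<open>2 * r - 1\<close>.\<close>
  let ?S = "insert (1/2) ((\<lambda>x. x / 2) ` S1 \<union> (\<lambda>x. (x + 1) / 2) ` S2)"
  have "\<exists>D. continuous_on {s..t} D \<and>
      (\<forall>r\<in>{s..t}. ((\<phi> \<circ> (curve_join \<gamma>1 \<gamma>2)) has_vector_derivative D r) (at r within {s..t}))"
    if U: "(U, \<phi>) \<in> atlas G" and st: "0 \<le> s" "s < t" "t \<le> 1" "{s<..<t} \<inter> ?S = {}"
      and sub: "(curve_join \<gamma>1 \<gamma>2) ` {s..t} \<subseteq> U" for U \<phi> s t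
  proof -
    have notin: "r \<notin> ?S" if "r \<in> {s<..<t}" for r using st(4) that by blast
    \<comment> \<open>As 1/2 belongs to \<open>?S\<close>, a break-free interval lies on one side of
      the seam.\<close>
    consider "t \<le> 1 / 2" | "s \<ge> 1 / 2"
      using notin[of "1/2"] by force
    then show ?thesis
    proof cases
      case 1
      show ?thesis
      proof (rule piecewise_C1_curve_affine_piece[OF S1(2) U, where m = 2 and c = 0])
        show "2 * r + 0 \<notin> S1" if "r \<in> {s<..<t}" for r
        proof
          assume "2 * r + 0 \<in> S1"
          then have "r \<in> (\<lambda>x. x / 2) ` S1" by (intro image_eqI[of _ _ "2 * r + 0"]) auto
          then show False using notin[OF that] by blast
        qed
      qed (use 1 st sub in \<open>auto simp: curve_join_def\<close>)
    next
      case 2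
      show ?thesis
      proof (rule piecewise_C1_curve_affine_piece[OF S2(2) U, where m = 2 and c = "-1"])
        show "2 * r + - 1 \<notin> S2" if "r \<in> {s<..<t}" for r
        proof
          assume "2 * r + - 1 \<in> S2"
          then have "r \<in> (\<lambda>x. (x + 1) / 2) ` S2" by (intro image_eqI[of _ _ "2 * r + - 1"]) auto
          then show False using notin[OF that] by blast
        qed
        show "(curve_join \<gamma>1 \<gamma>2) r = \<gamma>2 (2 * r + - 1)" if "r \<in> {s..t}" for r
        \<comment> \<open>At the seam \<open>curve_join\<close> takes its value from the first
          curve, so the matching condition is needed to read it on the second.\<close>
        proof (cases "r = 1 / 2")
          case True
          show ?thesis unfolding True using assms(3) by (simp add: curve_join_def)
        qed (use 2 that in \<open>auto simp: curve_join_def\<close>)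
      qed (use 2 st sub in auto)
    qed
  qed
  moreover have "pathin (topol G) (curve_join \<gamma>1 \<gamma>2)"
    using assms by (intro pathin_curve_join) (simp_all add: piecewise_C1_curve_def)
  moreover have "finite ?S" using S1(1) S2(1) by blast
  ultimately show ?thesis
    unfolding piecewise_C1_curve_def by (intro conjI exI[of _ ?S]) auto
qed

text \<open>Guarantees that the infimum in \<open>riemannian_dist\<close> runs over a nonempty set.
  A merely continuous path is replaced, on short parameter intervals, by chart segments between its
  points, and these are joined.\<close>

lemma piecewise_C1_connected:
  fixes G :: "('g, 'm::real_normed_vector) lie_group"
  assumes G: "smooth_manifold (topol G) (atlas G)" and conn: "path_connected_space (topol G)"
    and xy: "x \<in> topspace (topol G)" "y \<in> topspace (topol G)"
  shows "\<exists>\<gamma>. piecewise_C1_curve G \<gamma> \<and> \<gamma> 0 = x \<and> \<gamma> 1 = y"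
proof -
  obtain p where p: "pathin (topol G) p" "p 0 = x" "p 1 = y"
    using conn xy unfolding path_connected_space_def by blast
  \<comment> \<open>The range conditions sit inside the predicate because the local step of
    \<open>Bolzano\<close> also ranges over intervals that leave [0,1].\<close>
  let ?P = "\<lambda>a b. 0 \<le> a \<and> a \<le> b \<and> b \<le> 1 \<longrightarrow>
    (\<exists>\<gamma>. piecewise_C1_curve G \<gamma> \<and> \<gamma> 0 = p a \<and> \<gamma> 1 = p b)"
  have "?P 0 1"
  proof (rule Bolzano[where P = ?P])
    fix a b c
    assume trans: "?P a b" "?P b c" "a \<le> b" "b \<le> c"
    show "?P a c"
    proof
      assume "0 \<le> a \<and> a \<le> c \<and> c \<le> 1"
      then obtain \<gamma>1 \<gamma>2 where "piecewise_C1_curve G \<gamma>1" "\<gamma>1 0 = p a" "\<gamma>1 1 = p b"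
        "piecewise_C1_curve G \<gamma>2" "\<gamma>2 0 = p b" "\<gamma>2 1 = p c"
        using trans by force
      then show "\<exists>\<gamma>. piecewise_C1_curve G \<gamma> \<and> \<gamma> 0 = p a \<and> \<gamma> 1 = p c"
        using piecewise_C1_curve_join[of G \<gamma>1 \<gamma>2]
        by (intro exI[of _ "curve_join \<gamma>1 \<gamma>2"]) (auto simp: curve_join_def)
    qed
  next
    fix x :: real
    assume "0 \<le> x" "x \<le> 1"
    then have x: "x \<in> {0..1}" by simp
    then have "p x \<in> topspace (topol G)"
      using p(1) unfolding pathin_def continuous_map_def by auto
    then obtain V \<psi> where V: "(V, \<psi>) \<in> atlas G" "p x \<in> V"
      using G unfolding smooth_manifold_def by auto
    \<comment> \<open>A ball is convex, so segments between its points stay in the chart image,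
      which itself may fail to be convex.\<close>
    obtain \<epsilon> where \<epsilon>: "\<epsilon> > 0" "ball (\<psi> (p x)) \<epsilon> \<subseteq> \<psi> ` V"
      using chart_range_open[OF G V(1)] V(2) openE by blast
    let ?W = "{y \<in> V. \<psi> y \<in> ball (\<psi> (p x)) \<epsilon>}"
    have "openin (topol G) ?W"
      by (rule chart_preimage_open[OF G V(1) open_ball])
    then obtain d where d: "d > 0" "\<And>r. r \<in> {0..1} \<Longrightarrow> \<bar>r - x\<bar> < d \<Longrightarrow> p r \<in> ?W"
      using pathin_local[OF p(1) _ x] V(2) \<epsilon>(1) by (metis (mono_tags, lifting) centre_in_ball mem_Collect_eq)
    have "\<exists>\<gamma>. piecewise_C1_curve G \<gamma> \<and> \<gamma> 0 = p a \<and> \<gamma> 1 = p b"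
      if "a \<le> x" "x \<le> b" "b - a < d" "0 \<le> a" "b \<le> 1" for a b
    proof -
      have ab: "p a \<in> ?W" "p b \<in> ?W"
        by (rule d(2); use that in auto)+
      then have "closed_segment (\<psi> (p a)) (\<psi> (p b)) \<subseteq> ball (\<psi> (p x)) \<epsilon>"
        by (intro closed_segment_subset) auto
      then show ?thesis
        using chart_segment_curve[OF G V(1)] \<epsilon>(2) ab chart_inj[OF G V(1)]
        by (metis (mono_tags, lifting) inv_into_f_f mem_Collect_eq subset_trans)
    qed
    then show "\<exists>d>0. \<forall>a b. a \<le> x \<and> x \<le> b \<and> b - a < d \<longrightarrow> ?P a b"
      using d(1) by blast
  qed simp
  then show ?thesis using p by simp
qed

section \<open>Lie group homomorphisms to a vector group are Lipschitz\<close>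

context
  fixes G :: "('g, 'm::real_normed_vector) lie_group"
  assumes G: "is_lie_group G"
begin

lemma lie_group_manifold: "smooth_manifold (topol G) (atlas G)"
  and lie_group_group: "group G"
  and lie_group_topspace: "topspace (topol G) = carrier G"
  using G unfolding is_lie_group_def by blast+

lemma lie_group_chart:
  assumes "x \<in> carrier G"
  obtains U \<phi> where "(U, \<phi>) \<in> atlas G" "x \<in> U"
  using assms lie_group_manifold lie_group_topspace unfolding smooth_manifold_def by auto

lemma lie_group_chart_subset: "(U, \<phi>) \<in> atlas G \<Longrightarrow> U \<subseteq> carrier G"
  using openin_subset[OF chart_domain_open[OF lie_group_manifold]] lie_group_topspace by simp

section \<open>Derivatives of left translations and of homomorphisms in charts\<close>

lemma continuous_left_translation:
  assumes "a \<in> carrier G"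
  shows "continuous_map (topol G) (topol G) (\<lambda>y. a \<otimes>\<^bsub>G\<^esub> y)"
proof -
  have "continuous_map (prod_topology (topol G) (topol G)) (topol G) (\<lambda>(x, y). x \<otimes>\<^bsub>G\<^esub> y)"
    using G unfolding is_lie_group_def smooth_map_def by blast
  moreover have "continuous_map (topol G) (prod_topology (topol G) (topol G)) (\<lambda>y. (a, y))"
    using assms by (intro continuous_map_pairedI) (auto simp: lie_group_topspace)
  ultimately have "continuous_map (topol G) (topol G) ((\<lambda>(x, y). x \<otimes>\<^bsub>G\<^esub> y) \<circ> (\<lambda>y. (a, y)))"
    by (intro continuous_map_compose)
  then show ?thesis by (simp add: o_def)
qed

text \<open>In charts, translation by \<open>a\<close> is the smooth multiplication restricted to
  the slice with first coordinate \<open>\<kappa> a\<close>. Differentiability has to be known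
  before the \<open>frechet_derivative\<close> in \<open>left_invariant\<close> can be used as an
  actual derivative.\<close>

lemma left_translation_has_derivative:
  assumes a: "a \<in> carrier G" and U: "(U, \<phi>) \<in> atlas G" "x \<in> U"
    and V: "(V, \<psi>) \<in> atlas G" "a \<otimes>\<^bsub>G\<^esub> x \<in> V"
  defines "T \<equiv> \<psi> \<circ> (\<lambda>y. a \<otimes>\<^bsub>G\<^esub> y) \<circ> inv_into U \<phi>"
  shows "(T has_derivative frechet_derivative T (at (\<phi> x))) (at (\<phi> x))"
proof -
  note M = lie_group_manifold
  obtain W \<kappa> where W: "(W, \<kappa>) \<in> atlas G" "a \<in> W"
    using a by (rule lie_group_chart)
  let ?mult = "\<lambda>(x, y). x \<otimes>\<^bsub>G\<^esub> y"
  let ?F = "\<psi> \<circ> ?mult \<circ> inv_into (W \<times> U) (map_prod \<kappa> \<phi>)"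
  have "(W \<times> U, map_prod \<kappa> \<phi>) \<in> prod_atlas (atlas G) (atlas G)"
    using W(1) U(1) unfolding prod_atlas_def by force
  moreover have "\<forall>(P, \<pi>)\<in>prod_atlas (atlas G) (atlas G). \<forall>(V, \<psi>)\<in>atlas G.
      smooth_on (\<psi> \<circ> ?mult \<circ> inv_into P \<pi>) (\<pi> ` (P \<inter> ?mult -` V))"
    using G unfolding is_lie_group_def smooth_map_def by blast
  ultimately have "smooth_on ?F (map_prod \<kappa> \<phi> ` ((W \<times> U) \<inter> ?mult -` V))"
    using V(1) by fast
  moreover have "(\<kappa> a, \<phi> x) \<in> map_prod \<kappa> \<phi> ` ((W \<times> U) \<inter> ?mult -` V)"
    using W(2) U(2) V(2) by (intro image_eqI[of _ _ "(a, x)"]) auto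
  ultimately have F: "(?F has_derivative frechet_derivative ?F (at (\<kappa> a, \<phi> x))) (at (\<kappa> a, \<phi> x))"
    by (rule smooth_on_imp_has_derivative)
  have "((\<lambda>p. (\<kappa> a, p)) has_derivative (\<lambda>p. (0, p))) (at (\<phi> x))"
    by (auto intro!: derivative_eq_intros)
  from diff_chain_at[OF this F]
  have "((\<lambda>p. ?F (\<kappa> a, p)) has_derivative (\<lambda>p. frechet_derivative ?F (at (\<kappa> a, \<phi> x)) (0, p))) (at (\<phi> x))"
    by (simp add: o_def)
  then have "(T has_derivative (\<lambda>p. frechet_derivative ?F (at (\<kappa> a, \<phi> x)) (0, p))) (at (\<phi> x))"
  proof (rule has_derivative_transform_within_open)
    show "open (\<phi> ` U)" "\<phi> x \<in> \<phi> ` U"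
      using chart_range_open[OF M U(1)] U(2) by auto
    fix p assume "p \<in> \<phi> ` U"
    then obtain y where y: "y \<in> U" "p = \<phi> y" by blast
    have "inj_on (map_prod \<kappa> \<phi>) (W \<times> U)"
      using chart_inj[OF M W(1)] chart_inj[OF M U(1)] by (rule map_prod_inj_on)
    then have "inv_into (W \<times> U) (map_prod \<kappa> \<phi>) (map_prod \<kappa> \<phi> (a, y)) = (a, y)"
      using W(2) y(1) by (intro inv_into_f_f) auto
    moreover have "inv_into U \<phi> p = y"
      using chart_inj[OF M U(1)] y by simp
    ultimately show "?F (\<kappa> a, p) = T p"
      using y(2) by (simp add: T_def)
  qed
  then show ?thesis
    by (simp add: frechet_derivative_at[symmetric])
qed

lemma hom_add:
  assumes "lie_group_hom G (vector_lie_group :: ('v::real_normed_vector, 'v) lie_group) \<Theta>"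
    "x \<in> carrier G" "y \<in> carrier G"
  shows "\<Theta> (x \<otimes>\<^bsub>G\<^esub> y) = \<Theta> x + \<Theta> y"
  using assms unfolding lie_group_hom_def hom_def vector_lie_group_def by simp

lemma hom_chart_has_derivative:
  assumes "lie_group_hom G (vector_lie_group :: ('v::real_normed_vector, 'v) lie_group) \<Theta>"
    and U: "(U, \<phi>) \<in> atlas G" "x \<in> U"
  defines "T \<equiv> \<Theta> \<circ> inv_into U \<phi>"
  shows "(T has_derivative frechet_derivative T (at (\<phi> x))) (at (\<phi> x))"
proof -
  have "\<forall>(U, \<phi>)\<in>atlas G. \<forall>(V, \<psi>)\<in>{(UNIV, id)}.
      smooth_on (\<psi> \<circ> \<Theta> \<circ> inv_into U \<phi>) (\<phi> ` (U \<inter> \<Theta> -` V))"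
    using assms(1) unfolding lie_group_hom_def smooth_map_def vector_lie_group_def by simp
  from bspec[OF this U(1)] have "smooth_on T (\<phi> ` U)"
    by (simp add: T_def)
  then show ?thesis
    using U(2) by (intro smooth_on_imp_has_derivative) auto
qed

text \<open>Left translation by the inverse of \<open>x\<close> reduces the bound at \<open>x\<close> to the bound at the identity.\<close>

lemma hom_derivative_le_metric:
  assumes g: "riemannian_metric G g" "left_invariant G g"
    and \<Theta>: "lie_group_hom G (vector_lie_group :: ('v::real_normed_vector, 'v) lie_group) \<Theta>"
  obtains C where "C > 0"
    "\<And>U \<phi> x v. (U, \<phi>) \<in> atlas G \<Longrightarrow> x \<in> U \<Longrightarrow>
      norm (frechet_derivative (\<Theta> \<circ> inv_into U \<phi>) (at (\<phi> x)) v) \<le> C * sqrt (g (U, \<phi>) x v v)"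
proof -
  interpret group G by (rule lie_group_group)
  note M = lie_group_manifold
  obtain V \<psi> where V: "(V, \<psi>) \<in> atlas G" "\<one>\<^bsub>G\<^esub> \<in> V"
    using one_closed by (rule lie_group_chart)
  let ?A = "frechet_derivative (\<Theta> \<circ> inv_into V \<psi>) (at (\<psi> \<one>\<^bsub>G\<^esub>))"
  have A: "((\<Theta> \<circ> inv_into V \<psi>) has_derivative ?A) (at (\<psi> \<one>\<^bsub>G\<^esub>))"
    by (rule hom_chart_has_derivative[OF \<Theta> V])
  have fd: "\<exists>B::'m set. finite B \<and> span B = UNIV"
    using M unfolding smooth_manifold_def by blast
  have form: "bilinear (g (V, \<psi>) \<one>\<^bsub>G\<^esub>)" "\<And>v. v \<noteq> 0 \<Longrightarrow> g (V, \<psi>) \<one>\<^bsub>G\<^esub> v v > 0"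
    using g(1) V unfolding riemannian_metric_def by fast+
  obtain C where C: "C \<ge> 0" "\<And>v. norm (?A v) \<le> C * sqrt (g (V, \<psi>) \<one>\<^bsub>G\<^esub> v v)"
    using linear_le_sqrt_form[OF fd form has_derivative_linear[OF A]] by blast
  have bound: "norm (frechet_derivative (\<Theta> \<circ> inv_into U \<phi>) (at (\<phi> x)) v) \<le> C * sqrt (g (U, \<phi>) x v v)"
    if U: "(U, \<phi>) \<in> atlas G" "x \<in> U" for U \<phi> x v
  proof -
    have x: "x \<in> carrier G" using lie_group_chart_subset U by blast
    define a where "a = inv\<^bsub>G\<^esub> x"
    have a: "a \<in> carrier G" "a \<otimes>\<^bsub>G\<^esub> x = \<one>\<^bsub>G\<^esub>"
      using x by (simp_all add: a_def)
    let ?T = "\<psi> \<circ> (\<lambda>y. a \<otimes>\<^bsub>G\<^esub> y) \<circ> inv_into U \<phi>"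
    let ?E = "frechet_derivative ?T (at (\<phi> x))"
    have inv: "inv_into U \<phi> (\<phi> y) = y" if "y \<in> U" for y
      using chart_inj[OF M U(1)] that by simp
    have E: "(?T has_derivative ?E) (at (\<phi> x))"
      using V a by (intro left_translation_has_derivative U) auto
    have "?T (\<phi> x) = \<psi> \<one>\<^bsub>G\<^esub>"
      using a inv[OF U(2)] by simp
    then have "(((\<Theta> \<circ> inv_into V \<psi>) \<circ> ?T) has_derivative ?A \<circ> ?E) (at (\<phi> x))"
      using A E by (intro diff_chain_at) auto
    \<comment> \<open>Additivity gives
      \<open>\<Theta> y = \<Theta> (a \<otimes> y) - \<Theta> a\<close>: near \<open>x\<close>, up
      to a constant, \<open>\<Theta>\<close> is its own restriction near the identity composed with
      translation by \<open>a\<close>.\<close>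
    from has_derivative_diff[OF this has_derivative_const[of "\<Theta> a"]]
    have "((\<lambda>p. ((\<Theta> \<circ> inv_into V \<psi>) \<circ> ?T) p - \<Theta> a) has_derivative ?A \<circ> ?E) (at (\<phi> x))"
      by (simp only: diff_zero o_def)
    then have "((\<Theta> \<circ> inv_into U \<phi>) has_derivative ?A \<circ> ?E) (at (\<phi> x))"
    proof (rule has_derivative_transform_within_open)
      \<comment> \<open>The part of \<open>U\<close> that translation carries into \<open>V\<close>;
        there both chart inverses cancel.\<close>
      let ?Q = "U \<inter> {y \<in> topspace (topol G). a \<otimes>\<^bsub>G\<^esub> y \<in> V}"
      have "openin (topol G) ?Q"
        using openin_continuous_map_preimage[OF continuous_left_translation[OF a(1)]
            chart_domain_open[OF M V(1)]] chart_domain_open[OF M U(1)] by blast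
      then show "open (\<phi> ` ?Q)"
        by (rule chart_image_open[OF M U(1)]) blast
      show "\<phi> x \<in> \<phi> ` ?Q"
        using U(2) x a V(2) by (auto simp: lie_group_topspace)
      fix p assume "p \<in> \<phi> ` ?Q"
      then obtain y where y: "y \<in> U" "y \<in> carrier G" "a \<otimes>\<^bsub>G\<^esub> y \<in> V" "p = \<phi> y"
        by (auto simp: lie_group_topspace)
      have "inv_into V \<psi> (\<psi> (a \<otimes>\<^bsub>G\<^esub> y)) = a \<otimes>\<^bsub>G\<^esub> y"
        using chart_inj[OF M V(1)] y(3) by simp
      then show "((\<Theta> \<circ> inv_into V \<psi>) \<circ> ?T) p - \<Theta> a = (\<Theta> \<circ> inv_into U \<phi>) p"
        using y inv hom_add[OF \<Theta> a(1) y(2)] by simp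
    qed
    then have "frechet_derivative (\<Theta> \<circ> inv_into U \<phi>) (at (\<phi> x)) v = ?A (?E v)"
      by (simp add: frechet_derivative_at[symmetric])
    moreover have "g (V, \<psi>) \<one>\<^bsub>G\<^esub> (?E v) (?E v) = g (U, \<phi>) x v v"
    proof -
      have "\<forall>(U, \<phi>)\<in>atlas G. \<forall>(V, \<psi>)\<in>atlas G. \<forall>x\<in>U. a \<otimes>\<^bsub>G\<^esub> x \<in> V \<longrightarrow> (\<forall>v w.
          let D = frechet_derivative (\<psi> \<circ> (\<lambda>y. a \<otimes>\<^bsub>G\<^esub> y) \<circ> inv_into U \<phi>) (at (\<phi> x))
          in g (V, \<psi>) (a \<otimes>\<^bsub>G\<^esub> x) (D v) (D w) = g (U, \<phi>) x v w)"
        using g(2) a(1) unfolding left_invariant_def by blast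
      from bspec[OF bspec[OF this U(1), unfolded prod.case] V(1), unfolded prod.case, rule_format, OF U(2)]
      show ?thesis using a(2) V(2) by (simp add: Let_def)
    qed
    ultimately show ?thesis
      using C(2)[of "?E v"] by simp
  qed
  \<comment> \<open>Passing to \<open>C + 1\<close> makes the constant strictly positive, since it
    is divided by later. The increase is harmless because the form is nonnegative.\<close>
  then have "norm (frechet_derivative (\<Theta> \<circ> inv_into U \<phi>) (at (\<phi> x)) v) \<le> (C + 1) * sqrt (g (U, \<phi>) x v v)"
    if U: "(U, \<phi>) \<in> atlas G" "x \<in> U" for U \<phi> x v
  proof -
    have "bilinear (g (U, \<phi>) x)" "v \<noteq> 0 \<Longrightarrow> g (U, \<phi>) x v v > 0"
      using g(1) U unfolding riemannian_metric_def by fast+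
    then have "g (U, \<phi>) x v v \<ge> 0"
      by (cases "v = 0") (auto simp: bilinear_lzero)
    then have "C * sqrt (g (U, \<phi>) x v v) \<le> (C + 1) * sqrt (g (U, \<phi>) x v v)"
      by (simp add: mult_right_mono)
    then show ?thesis
      using bound[OF U, of v] by linarith
  qed
  then show ?thesis
    using C(1) that[of "C + 1"] by fastforce
qed

text \<open>\<open>curve_speed\<close> picks an arbitrary chart; its value agrees with the one in any given chart.\<close>

lemma curve_speed_chart:
  assumes g: "riemannian_metric G g" and U: "(U, \<phi>) \<in> atlas G"
    and ab: "0 \<le> a" "b \<le> 1" "t \<in> {a<..<b}" and sub: "\<gamma> ` {a<..<b} \<subseteq> U"
    and D: "((\<phi> \<circ> \<gamma>) has_vector_derivative D) (at t)"
  shows "curve_speed G g \<gamma> t = sqrt (g (U, \<phi>) (\<gamma> t) D D)"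
proof -
  note M = lie_group_manifold
  have t: "\<gamma> t \<in> U" using ab(3) sub by blast
  define c where "c = (SOME c. c \<in> atlas G \<and> \<gamma> t \<in> fst c)"
  have "c \<in> atlas G \<and> \<gamma> t \<in> fst c"
    unfolding c_def by (rule someI[of _ "(U, \<phi>)"]) (use U t in auto)
  then obtain V \<psi> where V: "c = (V, \<psi>)" "(V, \<psi>) \<in> atlas G" "\<gamma> t \<in> V"
    by (cases c) auto
  let ?E = "frechet_derivative (\<psi> \<circ> inv_into U \<phi>) (at (\<phi> (\<gamma> t)))"
  have "((\<psi> \<circ> inv_into U \<phi>) has_derivative ?E) (at (\<phi> (\<gamma> t)))"
    using t V(3) by (intro smooth_on_imp_has_derivative[OF chart_transition_smooth[OF M U V(2)]]) auto
  then have "((\<psi> \<circ> \<gamma>) has_vector_derivative ?E D) (at t within {a<..<b})"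
    by (rule vector_derivative_through_chart[OF chart_inj[OF M U] sub ab(3)
          has_vector_derivative_at_within[OF D]])
  then have "((\<psi> \<circ> \<gamma>) has_vector_derivative ?E D) (at t)"
    using ab(3) by (metis at_within_open open_greaterThanLessThan)
  \<comment> \<open>\<open>curve_speed\<close> differentiates within \<open>{0..1}\<close>; at the
    interior point \<open>t\<close> this agrees with the two-sided derivative.\<close>
  then have "vector_derivative (\<psi> \<circ> \<gamma>) (at t within {0..1}) = ?E D"
    using ab by (intro vector_derivative_at_within_ivl) auto
  then have "curve_speed G g \<gamma> t = sqrt (g (V, \<psi>) (\<gamma> t) (?E D) (?E D))"
    unfolding curve_speed_def c_def[symmetric] V(1) by (simp add: Let_def)
  also have "g (V, \<psi>) (\<gamma> t) (?E D) (?E D) = g (U, \<phi>) (\<gamma> t) D D"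
  proof -
    have "\<forall>(U, \<phi>)\<in>atlas G. \<forall>(V, \<psi>)\<in>atlas G. \<forall>x\<in>U \<inter> V. \<forall>v w.
        let D = frechet_derivative (\<psi> \<circ> inv_into U \<phi>) (at (\<phi> x))
        in g (V, \<psi>) x (D v) (D w) = g (U, \<phi>) x v w"
      by (rule g[unfolded riemannian_metric_def, THEN conjunct2])
    from bspec[OF bspec[OF this U, unfolded prod.case] V(2), unfolded prod.case, rule_format]
    show ?thesis using t V(3) unfolding Let_def by blast
  qed
  finally show ?thesis .
qed

section \<open>Integrating the derivative bound along curves\<close>

text \<open>Inside one chart the speed is, off the endpoints, a continuous function
  \<open>h\<close>, and the mean value inequality compares \<open>\<Theta> \<circ> \<gamma>\<close>
  with \<open>C\<close> times its indefinite integral. Integrability belongs to the conclusion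
  because pieces are glued later.\<close>

lemma hom_difference_le_length_piece:
  assumes g: "riemannian_metric G g"
    and \<Theta>: "lie_group_hom G (vector_lie_group :: ('v::real_normed_vector, 'v) lie_group) \<Theta>"
    and C: "\<And>U \<phi> x v. (U, \<phi>) \<in> atlas G \<Longrightarrow> x \<in> U \<Longrightarrow>
      norm (frechet_derivative (\<Theta> \<circ> inv_into U \<phi>) (at (\<phi> x)) v) \<le> C * sqrt (g (U, \<phi>) x v v)"
    and U: "(U, \<phi>) \<in> atlas G" and ab: "0 \<le> a" "a < b" "b \<le> 1" and sub: "\<gamma> ` {a..b} \<subseteq> U"
    and D: "continuous_on {a..b} D"
      "\<And>r. r \<in> {a..b} \<Longrightarrow> ((\<phi> \<circ> \<gamma>) has_vector_derivative D r) (at r within {a..b})"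
  shows "curve_speed G g \<gamma> integrable_on {a..b}"
    and "norm (\<Theta> (\<gamma> b) - \<Theta> (\<gamma> a)) \<le> C * integral {a..b} (curve_speed G g \<gamma>)"
proof -
  note M = lie_group_manifold
  have fd: "\<exists>B::'m set. finite B \<and> span B = UNIV"
    using M unfolding smooth_manifold_def by blast
  define h where "h t = sqrt (g (U, \<phi>) (\<gamma> t) (D t) (D t))" for t
  have bil: "bilinear (g (U, \<phi>) (\<gamma> t))" if "t \<in> {a..b}" for t
    using g U sub that unfolding riemannian_metric_def by fast
  have smooth: "smooth_on (\<lambda>p. g (U, \<phi>) (inv_into U \<phi> p) v w) (\<phi> ` U)" for v w
    using g U unfolding riemannian_metric_def by fast
  have cont: "continuous_on {a..b} (\<phi> \<circ> \<gamma>)"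
    by (rule continuous_on_vector_derivative) (rule D(2))
  have "continuous_on {a..b} (\<lambda>t. g (U, \<phi>) (\<gamma> t) v w)" for v w
  proof -
    have "continuous_on {a..b} (\<lambda>t. g (U, \<phi>) (inv_into U \<phi> ((\<phi> \<circ> \<gamma>) t)) v w)"
      using sub by (intro continuous_on_compose2[OF smooth_on_imp_continuous_on[OF smooth] cont]) auto
    then show ?thesis
      by (rule continuous_on_eq) (use sub chart_inj[OF M U] in \<open>auto simp: image_subset_iff\<close>)
  qed
  then have h: "continuous_on {a..b} h"
    unfolding h_def
    by (intro continuous_on_real_sqrt continuous_on_bilinear_diag[OF fd bil _ D(1)])
  have interior: "(F has_vector_derivative d) (at t)"
    if "(F has_vector_derivative d) (at t within {a..b})" "a < t" "t < b"
    for F :: "real \<Rightarrow> 'z::real_normed_vector" and d t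
    using that by (metis at_within_Icc_at)
  have speed: "curve_speed G g \<gamma> t = h t" if "t \<in> {a<..<b}" for t
    unfolding h_def using that ab sub
    by (intro curve_speed_chart[OF g U, of a b] interior[OF D(2)]) auto
  \<comment> \<open>At \<open>a\<close> and \<open>b\<close> the curve may have corners, so the
    speed there can differ from \<open>h\<close>; two points do not affect the integral.\<close>
  have int: "(curve_speed G g \<gamma> has_integral integral {a..b} h) {a..b}"
    using has_integral_spike_interior[of h _ a b "curve_speed G g \<gamma>"] speed
      integrable_integral[OF integrable_continuous_real[OF h]] by simp
  then show "curve_speed G g \<gamma> integrable_on {a..b}" by blast
  let ?d = "\<lambda>t. frechet_derivative (\<Theta> \<circ> inv_into U \<phi>) (at (\<phi> (\<gamma> t))) (D t)"
  have \<Theta>\<gamma>: "((\<Theta> \<circ> \<gamma>) has_vector_derivative ?d t) (at t within {a..b})" if "t \<in> {a..b}" for t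
    by (rule vector_derivative_through_chart[OF chart_inj[OF M U] sub that D(2)[OF that]
          hom_chart_has_derivative[OF \<Theta> U]]) (use sub that in blast)
  \<comment> \<open>The integral over \<open>{a..a}\<close> is 0; it is written so that the right
    side is an increment of the comparison function
    \<open>\<lambda>u. C * integral {a..u} h\<close>.\<close>
  have "norm ((\<Theta> \<circ> \<gamma>) b - (\<Theta> \<circ> \<gamma>) a) \<le> C * integral {a..b} h - C * integral {a..a} h"
  proof (rule differentiable_bound_general[OF ab(2)])
    show "continuous_on {a..b} (\<Theta> \<circ> \<gamma>)"
      by (rule continuous_on_vector_derivative) (rule \<Theta>\<gamma>)
    show "continuous_on {a..b} (\<lambda>u. C * integral {a..u} h)"
      by (intro continuous_intros indefinite_integral_continuous_1 integrable_continuous_real h)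
    fix t assume t: "a < t" "t < b"
    show "((\<Theta> \<circ> \<gamma>) has_vector_derivative ?d t) (at t)"
      using t by (intro interior[OF \<Theta>\<gamma>]) auto
    have "((\<lambda>u. integral {a..u} h) has_vector_derivative h t) (at t)"
      using t by (intro interior[OF integral_has_vector_derivative[OF h]]) auto
    then show "((\<lambda>u. C * integral {a..u} h) has_vector_derivative C * h t) (at t)"
      by (rule has_vector_derivative_mult_right)
    show "norm (?d t) \<le> C * h t"
      unfolding h_def using t sub by (intro C[OF U]) auto
  qed
  then show "norm (\<Theta> (\<gamma> b) - \<Theta> (\<gamma> a)) \<le> C * integral {a..b} (curve_speed G g \<gamma>)"
    using integral_unique[OF int] by simp
qed

text \<open>Lengths add under concatenation and increments obey the triangle inequality, so the
  chartwise estimate propagates from short intervals to [0,1] by bisection.\<close>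

lemma hom_difference_le_length:
  assumes g: "riemannian_metric G g"
    and \<Theta>: "lie_group_hom G (vector_lie_group :: ('v::real_normed_vector, 'v) lie_group) \<Theta>"
    and C: "\<And>U \<phi> x v. (U, \<phi>) \<in> atlas G \<Longrightarrow> x \<in> U \<Longrightarrow>
      norm (frechet_derivative (\<Theta> \<circ> inv_into U \<phi>) (at (\<phi> x)) v) \<le> C * sqrt (g (U, \<phi>) x v v)"
    and \<gamma>: "piecewise_C1_curve G \<gamma>"
  shows "norm (\<Theta> (\<gamma> 1) - \<Theta> (\<gamma> 0)) \<le> C * integral {0..1} (curve_speed G g \<gamma>)"
proof -
  note M = lie_group_manifold
  obtain S where S: "finite S" "\<forall>(U, \<phi>)\<in>atlas G. \<forall>s t.
           0 \<le> s \<and> s < t \<and> t \<le> 1 \<and> {s<..<t} \<inter> S = {} \<and> \<gamma> ` {s..t} \<subseteq> U \<longrightarrow>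
           (\<exists>D. continuous_on {s..t} D \<and>
              (\<forall>r\<in>{s..t}. ((\<phi> \<circ> \<gamma>) has_vector_derivative D r) (at r within {s..t})))"
    using \<gamma> unfolding piecewise_C1_curve_def by blast
  have p: "pathin (topol G) \<gamma>"
    using \<gamma> unfolding piecewise_C1_curve_def by blast
  \<comment> \<open>Integrability is carried along because additivity of the integral requires
    it.\<close>
  define Q where "Q a b \<longleftrightarrow> curve_speed G g \<gamma> integrable_on {a..b} \<and>
      norm (\<Theta> (\<gamma> b) - \<Theta> (\<gamma> a)) \<le> C * integral {a..b} (curve_speed G g \<gamma>)" for a b
  have Q_trans: "Q a c" if "Q a b" "Q b c" "a \<le> b" "b \<le> c" for a b c
  proof -
    have int: "curve_speed G g \<gamma> integrable_on {a..c}"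
      by (rule Henstock_Kurzweil_Integration.integrable_combine[OF that(3,4)])
        (use that in \<open>auto simp: Q_def\<close>)
    have "norm (\<Theta> (\<gamma> c) - \<Theta> (\<gamma> a)) \<le> norm (\<Theta> (\<gamma> b) - \<Theta> (\<gamma> a)) + norm (\<Theta> (\<gamma> c) - \<Theta> (\<gamma> b))"
      using norm_triangle_ineq[of "\<Theta> (\<gamma> b) - \<Theta> (\<gamma> a)" "\<Theta> (\<gamma> c) - \<Theta> (\<gamma> b)"] by simp
    also have "\<dots> \<le> C * (integral {a..b} (curve_speed G g \<gamma>) + integral {b..c} (curve_speed G g \<gamma>))"
      using that by (simp add: Q_def distrib_left)
    also have "\<dots> = C * integral {a..c} (curve_speed G g \<gamma>)"
      by (simp only: Henstock_Kurzweil_Integration.integral_combine[OF that(3,4) int])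
    finally show ?thesis
      using int by (simp add: Q_def)
  qed
  let ?P = "\<lambda>a b. 0 \<le> a \<and> a \<le> b \<and> b \<le> 1 \<longrightarrow> Q a b"
  have "?P 0 1"
  proof (rule Bolzano[where P = ?P])
    show "?P a c" if "?P a b" "?P b c" "a \<le> b" "b \<le> c" for a b c
      using that Q_trans by force
    fix x :: real
    assume "0 \<le> x" "x \<le> 1"
    then have x: "x \<in> {0..1}" by simp
    then have "\<gamma> x \<in> topspace (topol G)"
      using p unfolding pathin_def continuous_map_def by auto
    then obtain U \<phi> where U: "(U, \<phi>) \<in> atlas G" "\<gamma> x \<in> U"
      using lie_group_topspace lie_group_chart by metis
    obtain d1 where d1: "d1 > 0" "\<And>r. r \<in> {0..1} \<Longrightarrow> \<bar>r - x\<bar> < d1 \<Longrightarrow> \<gamma> r \<in> U"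
      using pathin_local[OF p chart_domain_open[OF M U(1)] x U(2)] by blast
    obtain d2 where d2: "d2 > 0" "\<And>r. r \<in> S \<Longrightarrow> r \<noteq> x \<Longrightarrow> d2 \<le> dist x r"
      using finite_set_avoid[OF S(1), of x] by blast
    \<comment> \<open>\<open>x\<close> may itself be a break point, so short intervals are treated
      with \<open>x\<close> as an endpoint; a general one is afterwards cut at
      \<open>x\<close>.\<close>
    have piece: "Q a b" if ab: "0 \<le> a" "a \<le> b" "b \<le> 1" "b - a < min d1 d2" "a = x \<or> b = x" for a b
    proof (cases "a = b")
      case True
      then show ?thesis
        using integrable_on_refl[of "curve_speed G g \<gamma>" b] by (simp add: Q_def)
    next
      case False
      have near: "\<gamma> ` {a..b} \<subseteq> U"
        using that d1(2) by force
      moreover have "{a<..<b} \<inter> S = {}"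
        using that d2(2) by (force simp: dist_real_def)
      moreover note bspec[OF S(2) U(1), unfolded prod.case, rule_format, of a b]
      moreover have "a < b" using False that by simp
      ultimately obtain D where "continuous_on {a..b} D"
        "\<And>r. r \<in> {a..b} \<Longrightarrow> ((\<phi> \<circ> \<gamma>) has_vector_derivative D r) (at r within {a..b})"
        using ab(1,3) by blast
      with near False that show ?thesis
        unfolding Q_def
        by (intro conjI hom_difference_le_length_piece[OF g \<Theta> C U(1), where D = D]) auto
    qed
    show "\<exists>d>0. \<forall>a b. a \<le> x \<and> x \<le> b \<and> b - a < d \<longrightarrow> ?P a b"
    proof (intro exI[of _ "min d1 d2"] conjI allI impI)
      fix a b assume "a \<le> x \<and> x \<le> b \<and> b - a < min d1 d2" "0 \<le> a \<and> a \<le> b \<and> b \<le> 1"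
      then show "Q a b"
        by (intro Q_trans[of a x b] piece) auto
    qed (use d1 d2 in auto)
  qed simp
  then show ?thesis by (simp add: Q_def)
qed

text \<open>Every admissible curve has length at least
  \<open>norm (\<Theta> y - \<Theta> x) / C\<close>, hence so does the infimum, given that
  path-connectedness provides at least one curve.\<close>

lemma hom_lipschitz:
  assumes g: "riemannian_metric G g" "left_invariant G g"
    and conn: "path_connected_space (topol G)"
    and \<Theta>: "lie_group_hom G (vector_lie_group :: ('v::real_normed_vector, 'v) lie_group) \<Theta>"
  obtains C where "C > 0"
    "\<And>x y. x \<in> carrier G \<Longrightarrow> y \<in> carrier G \<Longrightarrow> norm (\<Theta> y - \<Theta> x) \<le> C * riemannian_dist G g x y"
proof -
  obtain C where C: "C > 0"
    "\<And>U \<phi> x v. (U, \<phi>) \<in> atlas G \<Longrightarrow> x \<in> U \<Longrightarrow>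
      norm (frechet_derivative (\<Theta> \<circ> inv_into U \<phi>) (at (\<phi> x)) v) \<le> C * sqrt (g (U, \<phi>) x v v)"
    using hom_derivative_le_metric[OF g \<Theta>] by blast
  have "norm (\<Theta> y - \<Theta> x) \<le> C * riemannian_dist G g x y"
    if "x \<in> carrier G" "y \<in> carrier G" for x y
  proof -
    have "norm (\<Theta> y - \<Theta> x) / C \<le> riemannian_dist G g x y"
      unfolding riemannian_dist_def
    proof (rule cInf_greatest)
      show "{integral {0..1} (curve_speed G g \<gamma>) |\<gamma>. piecewise_C1_curve G \<gamma> \<and> \<gamma> 0 = x \<and> \<gamma> 1 = y} \<noteq> {}"
        using piecewise_C1_connected[OF lie_group_manifold conn] that lie_group_topspace by auto
    next
      fix l assume "l \<in> {integral {0..1} (curve_speed G g \<gamma>) |\<gamma>. piecewise_C1_curve G \<gamma> \<and> \<gamma> 0 = x \<and> \<gamma> 1 = y}"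
      then show "norm (\<Theta> y - \<Theta> x) / C \<le> l"
        using hom_difference_le_length[OF g(1) \<Theta> C(2)] C(1) by (auto simp: field_simps)
    qed
    then show ?thesis using C(1) by (simp add: field_simps)
  qed
  then show ?thesis using C(1) that by blast
qed

end

section \<open>The real Abelianization\<close>

lemma group_real_group: "group real_group"
  by (rule groupI) (auto simp: additive_group_def intro: exI[of _ "- x" for x])

lemma tensor_relations_subgroup:
  assumes "group A" "group B"
  shows "subgroup (tensor_relations A B) (free_Abelian_group (carrier A \<times> carrier B))"
proof -
  interpret A: group A by fact
  interpret B: group B by fact
  have "Poly_Mapping.keys (frag_of x - frag_of y - frag_of z) \<subseteq> S"
    if "x \<in> S" "y \<in> S" "z \<in> S" for x y z and S :: "('a \<times> 'c) set"
    using that keys_diff[of "frag_of x - frag_of y" "frag_of z"] keys_diff[of "frag_of x" "frag_of y"]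
    by auto
  then show ?thesis
    unfolding tensor_relations_def by (intro group.generate_is_subgroup) auto
qed

lemma comm_group_tensor_product:
  assumes "group A" "group B"
  shows "comm_group (tensor_product A B)"
  unfolding tensor_product_def
  by (intro comm_group.abelian_FactGroup abelian_free_Abelian_group tensor_relations_subgroup assms)

text \<open>Additivity in the first slot is one of the generating relations, so both sides are the
  same coset of \<open>tensor_relations\<close>.\<close>

lemma pure_tensor_mult_left:
  assumes A: "group A" and B: "group B" and ab: "a \<in> carrier A" "a' \<in> carrier A" "b \<in> carrier B"
  shows "pure_tensor A B (a \<otimes>\<^bsub>A\<^esub> a') b = pure_tensor A B a b \<otimes>\<^bsub>tensor_product A B\<^esub> pure_tensor A B a' b"
proof -
  let ?F = "free_Abelian_group (carrier A \<times> carrier B)"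
  let ?R = "tensor_relations A B"
  let ?x = "frag_of (a, b) + frag_of (a', b)" and ?y = "frag_of (a \<otimes>\<^bsub>A\<^esub> a', b)"
  have sub: "subgroup ?R ?F" using A B by (rule tensor_relations_subgroup)
  then interpret normal ?R ?F
    by (rule comm_group.subgroup_imp_normal[OF abelian_free_Abelian_group])
  have car: "frag_of (a, b) \<in> carrier ?F" "frag_of (a', b) \<in> carrier ?F"
    using ab by simp_all
  have "?y - frag_of (a, b) - frag_of (a', b) \<in> ?R"
    unfolding tensor_relations_def using ab by (intro generate.incl) blast
  moreover have "?y = (?y - frag_of (a, b) - frag_of (a', b)) \<otimes>\<^bsub>?F\<^esub> ?x"
    by (simp add: algebra_simps)
  ultimately have "?y \<in> ?R #>\<^bsub>?F\<^esub> ?x"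
    unfolding r_coset_def by blast
  then have "?R #>\<^bsub>?F\<^esub> ?y = ?R #>\<^bsub>?F\<^esub> ?x"
    using repr_independence[OF _ _ sub] m_closed[OF car] by simp
  also have "\<dots> = (?R #>\<^bsub>?F\<^esub> frag_of (a, b)) <#>\<^bsub>?F\<^esub> (?R #>\<^bsub>?F\<^esub> frag_of (a', b))"
    using rcos_sum[OF car] by simp
  finally show ?thesis
    unfolding pure_tensor_def tensor_product_def by simp
qed

lemma pure_tensor_closed:
  assumes "group A" "group B" "a \<in> carrier A" "b \<in> carrier B"
  shows "pure_tensor A B a b \<in> carrier (tensor_product A B)"
  using assms unfolding pure_tensor_def tensor_product_def carrier_FactGroup by (intro imageI) simp

lemma abelianization_map_hom:
  assumes "group K"
  shows "abelianization_map K \<in> hom K (abelianization K)"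
  using normal.r_coset_hom_Mod[OF group.derived_self_is_normal[OF assms]]
  unfolding abelianization_def abelianization_map_def[abs_def] .

lemma group_abelianization: "group K \<Longrightarrow> group (abelianization K)"
  unfolding abelianization_def
  by (intro normal.factorgroup_is_group group.derived_self_is_normal)

text \<open>Makes the defect, an expression in the tensor product, the image of a single group
  element.\<close>

lemma real_abelianization_map_hom:
  assumes "group K"
  shows "real_abelianization_map K \<in> hom K (real_tensor (abelianization K))"
proof -
  note ab = abelianization_map_hom[OF assms] and A = group_abelianization[OF assms]
  have one: "1 \<in> carrier real_group" by (simp add: additive_group_def)
  show ?thesis
  proof (rule homI)
    fix x assume "x \<in> carrier K"
    then show "real_abelianization_map K x \<in> carrier (real_tensor (abelianization K))"
      unfolding real_abelianization_map_def
      by (intro pure_tensor_closed A group_real_group one hom_in_carrier[OF ab])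
  next
    fix x y assume xy: "x \<in> carrier K" "y \<in> carrier K"
    show "real_abelianization_map K (x \<otimes>\<^bsub>K\<^esub> y) =
        real_abelianization_map K x \<otimes>\<^bsub>real_tensor (abelianization K)\<^esub> real_abelianization_map K y"
      unfolding real_abelianization_map_def hom_mult[OF ab xy]
      by (intro pure_tensor_mult_left A group_real_group one hom_in_carrier[OF ab] xy)
  qed
qed

section \<open>Finiteness of bounded sets in the lattice and in the Abelianization\<close>

text \<open>The coordinates \<open>v \<bullet> e i\<close> determine \<open>v\<close> because the
  \<open>e i\<close> span, and by Cauchy-Schwarz with unit vectors they are integers of absolute
  value at most \<open>R\<close>.\<close>

lemma finite_int_lattice_ball:
  fixes e :: "nat \<Rightarrow> 'v::real_inner"
  assumes "standard_basis d e"
  shows "finite {v \<in> int_lattice d e. norm v \<le> R}"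
proof -
  have span: "span (e ` {..<d}) = UNIV"
    using assms unfolding standard_basis_def by blast
  have norm_e: "norm (e i) = 1" if "i < d" for i
    using assms that unfolding standard_basis_def by (auto simp: norm_eq_1)
  let ?f = "\<lambda>v. restrict (\<lambda>i. v \<bullet> e i) {..<d}"
  have "inj ?f"
  proof (rule injI)
    fix v w assume eq: "?f v = ?f w"
    have "(v - w) \<bullet> e i = 0" if "i < d" for i
      using fun_cong[OF eq, of i] that by (simp add: inner_diff_left)
    then have "orthogonal (v - w) u" if "u \<in> span (e ` {..<d})" for u
      using that by (intro orthogonal_to_span[OF that]) (auto simp: orthogonal_def)
    moreover have "v - w \<in> span (e ` {..<d})"
      using span by simp
    ultimately have "orthogonal (v - w) (v - w)" by blast
    then show "v = w" by (simp add: orthogonal_def)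
  qed
  moreover have "?f ` {v \<in> int_lattice d e. norm v \<le> R} \<subseteq> (\<Pi>\<^sub>E i\<in>{..<d}. {k \<in> \<int>. \<bar>k\<bar> \<le> R})"
  proof clarify
    fix v i assume v: "v \<in> int_lattice d e" "norm v \<le> R"
    have "\<bar>v \<bullet> e i\<bar> \<le> R" if "i < d" for i
      using Cauchy_Schwarz_ineq2[of v "e i"] norm_e[OF that] v(2) by simp
    then show "?f v \<in> (\<Pi>\<^sub>E i\<in>{..<d}. {k \<in> \<int>. \<bar>k\<bar> \<le> R})"
      using v(1) by (auto simp: int_lattice_def)
  qed
  moreover have "finite (\<Pi>\<^sub>E i\<in>{..<d}. {k \<in> \<int>. \<bar>k\<bar> \<le> R})"
    by (intro finite_PiE finite_abs_int_segment) auto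
  ultimately show ?thesis
    by (meson finite_imageD finite_subset inj_on_subset subset_UNIV)
qed

text \<open>The set of such \<open>x\<close> can be infinite, as \<open>\<theta>\<close> forgets the
  derived subgroup. Only their classes are counted: \<open>\<sigma> \<circ> \<iota>\<close> embeds
  them in a lattice ball, and the map to the tensor product factors through them.\<close>

lemma finite_real_abelianization_ball:
  assumes Rd: "standard_basis d e" and agr: "agrees_with_abelianization K d e \<theta>" and K: "group K"
  shows "finite (real_abelianization_map K ` {x \<in> carrier K. norm (\<theta> x) \<le> R})"
proof -
  let ?Z = "additive_group (int_lattice d e)" and ?X = "{x \<in> carrier K. norm (\<theta> x) \<le> R}"
  obtain \<iota> \<sigma> where \<iota>: "\<iota> \<in> iso (abelianization K) ?Z" and \<sigma>: "\<sigma> \<in> iso ?Z ?Z"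
    and \<theta>: "\<And>x. x \<in> carrier K \<Longrightarrow> \<theta> x = \<sigma> (\<iota> (abelianization_map K x))"
    using agr unfolding agrees_with_abelianization_def by (auto simp: Let_def)
  have "bij_betw (\<sigma> \<circ> \<iota>) (carrier (abelianization K)) (carrier ?Z)"
    using \<iota> \<sigma> by (auto simp: iso_def intro: bij_betw_trans)
  moreover have sub: "abelianization_map K ` ?X \<subseteq> carrier (abelianization K)"
    using hom_in_carrier[OF abelianization_map_hom[OF K]] by blast
  ultimately have inj: "inj_on (\<sigma> \<circ> \<iota>) (abelianization_map K ` ?X)"
    and mem: "\<And>x. x \<in> ?X \<Longrightarrow> (\<sigma> \<circ> \<iota>) (abelianization_map K x) \<in> int_lattice d e"
    by (auto simp: bij_betw_def additive_group_def intro: inj_on_subset)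
  have "(\<sigma> \<circ> \<iota>) ` abelianization_map K ` ?X \<subseteq> {v \<in> int_lattice d e. norm v \<le> R}"
    using mem \<theta> by auto
  then have "finite (abelianization_map K ` ?X)"
    using finite_int_lattice_ball[OF Rd] inj by (meson finite_imageD finite_subset)
  then have "finite ((\<lambda>c. pure_tensor (abelianization K) real_group c 1) ` abelianization_map K ` ?X)"
    by (rule finite_imageI)
  then show ?thesis
    by (simp add: image_image real_abelianization_map_def)
qed

lemma additive_inv:
  fixes f :: "'a \<Rightarrow> 'v::group_add"
  assumes "group K" and add: "\<And>x y. x \<in> carrier K \<Longrightarrow> y \<in> carrier K \<Longrightarrow> f (x \<otimes>\<^bsub>K\<^esub> y) = f x + f y"
    and x: "x \<in> carrier K"
  shows "f (inv\<^bsub>K\<^esub> x) = - f x"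
proof -
  interpret group K by fact
  have "f \<one>\<^bsub>K\<^esub> = f \<one>\<^bsub>K\<^esub> + f \<one>\<^bsub>K\<^esub>"
    using add[of "\<one>\<^bsub>K\<^esub>" "\<one>\<^bsub>K\<^esub>"] by simp
  then have "f \<one>\<^bsub>K\<^esub> = 0" by (metis add.right_neutral add_left_cancel)
  then show ?thesis
    using add[of x "inv\<^bsub>K\<^esub> x"] x by (simp add: add_eq_0_iff)
qed

theorem corollary7p8:
  fixes G :: "('g, 'm::real_normed_vector) lie_group"
    and H :: "('h, 'k::real_normed_vector) lie_group"
    and N :: "'g set" and M :: "'h set"
    and gG :: "('g, 'm) metric_tensor" and gH :: "('h, 'k) metric_tensor"
    and SN :: "'g set" and SM :: "'h set"
    and \<nu> :: "('h set \<times> real \<Rightarrow>\<^sub>0 int) set \<Rightarrow> real"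
    and d :: nat and e :: "nat \<Rightarrow> 'v::real_inner"
    and \<Theta>G :: "'g \<Rightarrow> 'v" and \<Theta>H :: "'h \<Rightarrow> 'v"
    and \<Phi> \<Psi> :: "'g \<Rightarrow> 'h" and L :: "'v \<Rightarrow> 'v" and b :: 'v and C0 :: real
  assumes G: "is_lie_group G" "simply_connected_space (topol G)" "nilpotent_group G"
    and H: "is_lie_group H" "simply_connected_space (topol H)" "nilpotent_group H"
    and gG: "riemannian_metric G gG" "left_invariant G gG"
    and gH: "riemannian_metric H gH" "left_invariant H gH"
    and N: "uniform_lattice G N" and M: "uniform_lattice H M"
    and SN: "finite SN" "SN \<subseteq> N" "generate G SN = N"
    and SM: "finite SM" "SM \<subseteq> M" "generate H SM = M"
    and \<nu>: "norm_on_real_tensor (abelianization (H\<lparr>carrier := M\<rparr>)) \<nu>"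
    and Rd: "standard_basis d e"
    and \<Theta>G: "lie_group_hom G vector_lie_group \<Theta>G"
      "nilpotent_group (G\<lparr>carrier := kernel G (vector_lie_group :: ('v, 'v) lie_group) \<Theta>G\<rparr>)"
    and \<Theta>H: "lie_group_hom H vector_lie_group \<Theta>H"
      "nilpotent_group (H\<lparr>carrier := kernel H (vector_lie_group :: ('v, 'v) lie_group) \<Theta>H\<rparr>)"
    and i_G: "\<Theta>G ` N \<subseteq> int_lattice d e"
      "agrees_with_abelianization (G\<lparr>carrier := N\<rparr>) d e \<Theta>G"
    and i_H: "\<Theta>H ` M \<subseteq> int_lattice d e"
      "agrees_with_abelianization (H\<lparr>carrier := M\<rparr>) d e \<Theta>H"
    and ii: "quasi_isometry (carrier G) (riemannian_dist G gG) (carrier H) (riemannian_dist H gH) \<Phi>"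
      "linear L" "C0 \<ge> 0"
      "\<And>g. g \<in> carrier G \<Longrightarrow> norm (\<Theta>H (\<Phi> g) - (L (\<Theta>G g) + b)) \<le> C0"
    and \<Psi>: "quasi_isometry N (word_dist G SN) M (word_dist H SM) \<Psi>"
      "bdd_above ((\<lambda>x. riemannian_dist H gH (\<Psi> x) (\<Phi> x)) ` N)"
  shows "bounded_abelian_defect (G\<lparr>carrier := N\<rparr>) (H\<lparr>carrier := M\<rparr>) \<nu> \<Psi>"
proof -
  let ?K = "H\<lparr>carrier := M\<rparr>"
  let ?T = "real_tensor (abelianization ?K)" and ?\<pi> = "real_abelianization_map ?K"
  have groupH: "group H" using H(1) by (rule lie_group_group)
  have subM: "subgroup M H" and subN: "subgroup N G"
    using M N unfolding uniform_lattice_def by blast+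
  then have MH: "M \<subseteq> carrier H" and NG: "N \<subseteq> carrier G"
    by (auto dest: subgroup.subset)
  have K: "group ?K" using subM groupH by (rule subgroup.subgroup_is_group)
  interpret K: group ?K by (rule K)
  have "group ?T"
    using comm_group_tensor_product[OF group_abelianization[OF K] group_real_group]
    by (rule comm_group.axioms(2))
  then interpret \<pi>: group_hom ?K ?T ?\<pi>
    using real_abelianization_map_hom[OF K] K by (simp add: group_hom_def group_hom_axioms_def)
  have \<Psi>M: "\<Psi> x \<in> M" if "x \<in> N" for x
    using \<Psi>(1) that unfolding quasi_isometry_def by blast
  have \<Phi>H: "\<Phi> x \<in> carrier H" if "x \<in> N" for x
    using ii(1) that NG unfolding quasi_isometry_def by blast
  \<comment> \<open>Stated for the restricted group \<open>?K\<close>, since the inverses in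
    \<open>?m\<close> are formed there.\<close>
  have add: "\<Theta>H (x \<otimes>\<^bsub>?K\<^esub> y) = \<Theta>H x + \<Theta>H y" if "x \<in> carrier ?K" "y \<in> carrier ?K" for x y
    using hom_add[OF H(1) \<Theta>H(1)] that MH by auto
  obtain C where C: "C > 0" "\<And>x y. x \<in> carrier H \<Longrightarrow> y \<in> carrier H \<Longrightarrow>
      norm (\<Theta>H y - \<Theta>H x) \<le> C * riemannian_dist H gH x y"
    using hom_lipschitz[OF H(1) gH _ \<Theta>H(1)] H(2) unfolding simply_connected_space_def by blast
  obtain B where B: "\<And>x. x \<in> N \<Longrightarrow> riemannian_dist H gH (\<Psi> x) (\<Phi> x) \<le> B"
    using \<Psi>(2) unfolding bdd_above_def by blast
  \<comment> \<open>The error of the affine model for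
    \<open>\<Theta>H \<circ> \<Psi>\<close>.\<close>
  define r where "r x = \<Theta>H (\<Psi> x) - (L (\<Theta>G x) + b)" for x
  \<comment> \<open>\<open>C * B\<close> is the cost of replacing \<open>\<Phi>\<close> by
    \<open>\<Psi>\<close>, through the Lipschitz constant; \<open>C0\<close> is the error of the
    affine model for \<open>\<Phi>\<close>.\<close>
  define R where "R = C * B + C0"
  have r: "norm (r x) \<le> R" if x: "x \<in> N" for x
  proof -
    have "norm (\<Theta>H (\<Phi> x) - \<Theta>H (\<Psi> x)) \<le> C * riemannian_dist H gH (\<Psi> x) (\<Phi> x)"
      using C(2) \<Psi>M[OF x] \<Phi>H[OF x] MH by blast
    also have "\<dots> \<le> C * B"
      using B[OF x] C(1) by (simp add: mult_left_mono)
    finally have 1: "norm (\<Theta>H (\<Phi> x) - \<Theta>H (\<Psi> x)) \<le> C * B" .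
    have 2: "norm (\<Theta>H (\<Phi> x) - (L (\<Theta>G x) + b)) \<le> C0"
      using ii(4) x NG by blast
    have "r x = (\<Theta>H (\<Phi> x) - (L (\<Theta>G x) + b)) - (\<Theta>H (\<Phi> x) - \<Theta>H (\<Psi> x))"
      by (simp add: r_def)
    then show ?thesis
      using norm_triangle_ineq4[of "\<Theta>H (\<Phi> x) - (L (\<Theta>G x) + b)" "\<Theta>H (\<Phi> x) - \<Theta>H (\<Psi> x)"] 1 2
      by (simp only: R_def)
  qed
  let ?m = "\<lambda>x y. \<Psi> (x \<otimes>\<^bsub>G\<^esub> y) \<otimes>\<^bsub>?K\<^esub> inv\<^bsub>?K\<^esub> \<Psi> x \<otimes>\<^bsub>?K\<^esub> inv\<^bsub>?K\<^esub> \<Psi> y"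
  \<comment> \<open>Three error terms, at \<open>x\<close>, \<open>y\<close> and their product, and
    one copy of \<open>b\<close>, which enters the defect once with a plus sign and twice with a
    minus sign.\<close>
  let ?X = "{z \<in> carrier ?K. norm (\<Theta>H z) \<le> 3 * R + norm b}"
  have m: "?m x y \<in> ?X \<and> ?\<pi> (\<Psi> (x \<otimes>\<^bsub>G\<^esub> y)) \<otimes>\<^bsub>?T\<^esub> inv\<^bsub>?T\<^esub> ?\<pi> (\<Psi> x) \<otimes>\<^bsub>?T\<^esub> inv\<^bsub>?T\<^esub> ?\<pi> (\<Psi> y) = ?\<pi> (?m x y)"
    if xy: "x \<in> N" "y \<in> N" for x y
  proof -
    have xyN: "x \<otimes>\<^bsub>G\<^esub> y \<in> N" using subN xy by (rule subgroup.m_closed)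
    have car: "\<Psi> x \<in> carrier ?K" "\<Psi> y \<in> carrier ?K" "\<Psi> (x \<otimes>\<^bsub>G\<^esub> y) \<in> carrier ?K"
      using \<Psi>M xy xyN by simp_all
    note inv_car = K.inv_closed[OF car(1)] K.inv_closed[OF car(2)]
    note inv_add = additive_inv[where f = \<Theta>H, OF K add car(1)] additive_inv[where f = \<Theta>H, OF K add car(2)]
    have "\<Theta>H (?m x y) = \<Theta>H (\<Psi> (x \<otimes>\<^bsub>G\<^esub> y)) - \<Theta>H (\<Psi> x) - \<Theta>H (\<Psi> y)"
      by (simp only: add K.m_closed car inv_car inv_add diff_conv_add_uminus)
    also have "\<Theta>G (x \<otimes>\<^bsub>G\<^esub> y) = \<Theta>G x + \<Theta>G y"
      using hom_add[OF G(1) \<Theta>G(1)] xy NG by blast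
    then have "\<Theta>H (\<Psi> (x \<otimes>\<^bsub>G\<^esub> y)) - \<Theta>H (\<Psi> x) - \<Theta>H (\<Psi> y) = r (x \<otimes>\<^bsub>G\<^esub> y) - r x - r y - b"
      by (simp add: r_def linear_add[OF ii(2)])
    also have "norm \<dots> \<le> norm (r (x \<otimes>\<^bsub>G\<^esub> y)) + norm (r x) + norm (r y) + norm b"
      by (intro order.trans[OF norm_triangle_ineq4] add_mono order.refl)
    also have "\<dots> \<le> 3 * R + norm b"
      using r[OF xy(1)] r[OF xy(2)] r[OF xyN] by linarith
    finally have "norm (\<Theta>H (?m x y)) \<le> 3 * R + norm b" .
    moreover have "?m x y \<in> carrier ?K"
      by (intro K.m_closed car inv_car)
    moreover have "?\<pi> (\<Psi> (x \<otimes>\<^bsub>G\<^esub> y)) \<otimes>\<^bsub>?T\<^esub> inv\<^bsub>?T\<^esub> ?\<pi> (\<Psi> x) \<otimes>\<^bsub>?T\<^esub> inv\<^bsub>?T\<^esub> ?\<pi> (\<Psi> y) = ?\<pi> (?m x y)"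
      by (simp only: \<pi>.hom_mult \<pi>.hom_inv K.m_closed car inv_car)
    ultimately show ?thesis by blast
  qed
  have "finite (\<nu> ` ?\<pi> ` ?X)"
    by (intro finite_imageI finite_real_abelianization_ball[OF Rd i_H(2) K])
  moreover have "{\<nu> (?\<pi> (\<Psi> (x \<otimes>\<^bsub>G\<^esub> y)) \<otimes>\<^bsub>?T\<^esub> inv\<^bsub>?T\<^esub> ?\<pi> (\<Psi> x) \<otimes>\<^bsub>?T\<^esub> inv\<^bsub>?T\<^esub> ?\<pi> (\<Psi> y)) |x y.
      x \<in> N \<and> y \<in> N} \<subseteq> \<nu> ` ?\<pi> ` ?X"
    using m by blast
  ultimately show ?thesis
    unfolding bounded_abelian_defect_def Let_def
    by (intro bdd_above_finite) (auto elim: finite_subset[rotated])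
qed

end
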